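(* Let $d\ge3$ and let $\mathbf X=(X_t)_{t\ge0}$ be an isotropic unimodal Lévy process in $\mathbb R^d$ with Lévy–Khintchine exponent $\psi$, and let $G(x)$ be the density of the absolutely continuous part of its potential measure. Assume that $\psi\in\mathcal R^0_\alpha$ for some $\alpha\in(0,2]$. Then $$\lim_{|x|\to+\infty}|x|^d\,\psi(|x|^{-1})\,G(x)=\tilde{\mathcal A}_{d,\alpha},\qquad\text{where}\qquad \tilde{\mathcal A}_{d,\alpha}=2^{-\alpha}\pi^{-d/2}\frac{\Gamma((d-\alpha)/2)}{\Gamma(\alpha/2)}.$$
   Context: An isotropic Lévy process in $\mathbb R^d$ is a Lévy process $\mathbf X=(X_t)_{t\ge0}$ with $X_0=0$ a.s. such that each $X_t$ has a rotationally invariant distribution $p(t,dx)$. Its Lévy–Khintchine exponent $\psi$ is defined by $\int_{\mathbb R^d}e^{i\langle\xi,x\rangle}p(t,dx)=e^{-t\psi(\xi)}$, with $\psi(\xi)=\int_{\mathbb R^d}(1-\cos\langle\xi,x\rangle)\,\nu(dx)+\eta|\xi|^2$, where $\eta\ge0$ and $\nu$ is a rotationally invariant Lévy measure. The function $\psi$ is radial and one writes $\psi(r)=\psi(\xi)$ for $r=|\xi|$. A Borel measure is isotropic unimodal if it is absolutely continuous on $\mathbb R^d\setminus\{0\}$ with a radial, radially non-increasing density. $\mathbf X$ is isotropic unimodal if $p(t,dx)$ is isotropic unimodal for every $t>0$; $p(t,x)$ denotes the radial, radially non-increasing density on $\mathbb R^d\setminus\{0\}$. The potential measure is $G(A)=\int_0^\infty\mathbb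 P(X_t\in A)\,dt$ for Borel $A\subset\mathbb R^d$ (the process is transient since $d\ge3$). The same letter $G(x)$ denotes the density of the part of this measure absolutely continuous with respect to Lebesgue measure, taken radial and radially non-increasing on $\mathbb R^d\setminus\{0\}$, namely $G(x)=\int_0^\infty p(t,x)\,dt$. Regular variation: $f:[x_0,+\infty)\to(0,+\infty)$, $x_0>0$, is in $\mathcal R^\infty_\alpha$ (regularly varying of index $\alpha$ at infinity) if $f(\lambda x)/f(x)\to\lambda^\alpha$ as $x\to+\infty$ for each $\lambda>0$. A function $f$, positive near zero, is in $\mathcal R^0_\alpha$ (regularly varying of index $\alpha$ at zero) if $x\mapsto f(x^{-1})^{-1}$ is in $\mathcal R^\infty_\alpha$, i.e. $f(\lambda x)/f(x)\to\lambda^\alpha$ as $x\to0^+$ for each $\lambda>0$. The condition $\psi\in\mathcal R^0_\alpha$ refers to $r\mapsto\psi(r)$. *)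

theory Defs
  imports "HOL-Probability.Probability"
begin

definition regularly_varying_at_infinity :: "real \<Rightarrow> (real \<Rightarrow> real) \<Rightarrow> bool" where
  "regularly_varying_at_infinity \<alpha> f \<longleftrightarrow>
     (\<exists>x0>0. \<forall>x\<ge>x0. 0 < f x) \<and>
     (\<forall>l>0. ((\<lambda>x. f (l * x) / f x) \<longlongrightarrow> l powr \<alpha>) at_top)"

definition regularly_varying_at_zero :: "real \<Rightarrow> (real \<Rightarrow> real) \<Rightarrow> bool" where
  "regularly_varying_at_zero \<alpha> f \<longleftrightarrow>
     regularly_varying_at_infinity \<alpha> (\<lambda>x. inverse (f (inverse x)))"

text \<open>Convention: orthogonal transformations are used for rotations. In dimension at least 2,
  invariance under the full orthogonal group and under its determinant-one subgroup coincide.\<close>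

definition rotation_invariant :: "'a::euclidean_space measure \<Rightarrow> bool" where
  "rotation_invariant \<mu> \<longleftrightarrow>
     (\<forall>T. orthogonal_transformation T \<longrightarrow> distr \<mu> borel T = \<mu>)"

text \<open>The value at the origin is left unconstrained. Taking \<open>norm x = norm y\<close> in both
  directions shows that such a function is radial.\<close>

definition radially_nonincreasing :: "('a::real_normed_vector \<Rightarrow> real) \<Rightarrow> bool" where
  "radially_nonincreasing g \<longleftrightarrow> (\<forall>x y. x \<noteq> 0 \<longrightarrow> norm x \<le> norm y \<longrightarrow> g y \<le> g x)"

definition isotropic_unimodal_measure :: "'a::euclidean_space measure \<Rightarrow> bool" where
  "isotropic_unimodal_measure \<mu> \<longleftrightarrow>
     sets \<mu> = sets borel \<and>
     (\<exists>g \<in> borel_measurable borel. (\<forall>x. 0 \<le> g x) \<and> radially_nonincreasing g \<and>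
        (\<forall>A \<in> sets borel. 0 \<notin> A \<longrightarrow>
           emeasure \<mu> A = (\<integral>\<^sup>+x\<in>A. ennreal (g x) \<partial>lborel)))"

text \<open>Processes are indexed by all reals, but only times \<open>t \<ge> 0\<close> matter. Stochastic
  continuity is required instead of right-continuous paths with left limits; the latter implies
  the former in the presence of the other conditions, so both conventions are covered.\<close>

definition levy_process ::
    "'w measure \<Rightarrow> (real \<Rightarrow> 'w \<Rightarrow> 'a::euclidean_space) \<Rightarrow> bool" where
  "levy_process M X \<longleftrightarrow>
     prob_space M \<and>
     (\<forall>t\<ge>0. X t \<in> borel_measurable M) \<and>
     (AE \<omega> in M. X 0 \<omega> = 0) \<and>
     (\<forall>n t. 0 \<le> t 0 \<longrightarrow> (\<forall>i<n. t i \<le> t (Suc i)) \<longrightarrow>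
        prob_space.indep_vars M (\<lambda>_. borel) (\<lambda>i \<omega>. X (t (Suc i)) \<omega> - X (t i) \<omega>) {..<n::nat}) \<and>
     (\<forall>s\<ge>0. \<forall>t\<ge>0. distr M borel (\<lambda>\<omega>. X (s + t) \<omega> - X s \<omega>) = distr M borel (X t)) \<and>
     (\<forall>s\<ge>0. \<forall>\<epsilon>>0.
        ((\<lambda>t. measure M {\<omega> \<in> space M. \<epsilon> < dist (X t \<omega>) (X s \<omega>)}) \<longlongrightarrow> 0) (at s within {0..}))"

definition isotropic_levy_process ::
    "'w measure \<Rightarrow> (real \<Rightarrow> 'w \<Rightarrow> 'a::euclidean_space) \<Rightarrow> bool" where
  "isotropic_levy_process M X \<longleftrightarrow>
     levy_process M X \<and> (\<forall>t\<ge>0. rotation_invariant (distr M borel (X t)))"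

definition isotropic_unimodal_levy_process ::
    "'w measure \<Rightarrow> (real \<Rightarrow> 'w \<Rightarrow> 'a::euclidean_space) \<Rightarrow> bool" where
  "isotropic_unimodal_levy_process M X \<longleftrightarrow>
     isotropic_levy_process M X \<and> (\<forall>t>0. isotropic_unimodal_measure (distr M borel (X t)))"

definition levy_measure :: "'a::euclidean_space measure \<Rightarrow> bool" where
  "levy_measure \<nu> \<longleftrightarrow>
     sets \<nu> = sets borel \<and> emeasure \<nu> {0} = 0 \<and>
     (\<integral>\<^sup>+x. ennreal (min 1 ((norm x)\<^sup>2)) \<partial>\<nu>) < \<infinity>"

text \<open>The exponent of an isotropic process. The first conjunct determines the real-valued
  function \<open>\<psi>\<close> uniquely; the second is its Levy-Khintchine representation, with
  Gaussian coefficient \<open>\<eta>\<close> and rotation invariant Levy measure \<open>\<nu>\<close>.\<close>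

definition levy_khintchine_exponent ::
    "'w measure \<Rightarrow> (real \<Rightarrow> 'w \<Rightarrow> 'a::euclidean_space) \<Rightarrow> ('a \<Rightarrow> real) \<Rightarrow> bool" where
  "levy_khintchine_exponent M X \<psi> \<longleftrightarrow>
     (\<forall>t\<ge>0. \<forall>\<xi>. (CLINT x|distr M borel (X t). iexp (\<xi> \<bullet> x)) = of_real (exp (- t * \<psi> \<xi>))) \<and>
     (\<exists>\<eta> \<nu>. 0 \<le> \<eta> \<and> levy_measure \<nu> \<and> rotation_invariant \<nu> \<and>
        (\<forall>\<xi>. \<psi> \<xi> = (LINT x|\<nu>. 1 - cos (\<xi> \<bullet> x)) + \<eta> * (norm \<xi>)\<^sup>2))"

text \<open>The function of \<open>r \<ge> 0\<close> induced by a radial function on the whole space.\<close>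

definition radial_profile :: "('a::euclidean_space \<Rightarrow> real) \<Rightarrow> real \<Rightarrow> real" where
  "radial_profile f r = (THE c. \<forall>x. norm x = r \<longrightarrow> f x = c)"

lemma radial_profile_norm:
  assumes "\<And>x y. norm x = norm y \<Longrightarrow> f x = f y"
  shows "radial_profile f (norm x) = f x"
  unfolding radial_profile_def
proof (rule the_equality)
  show "\<forall>y. norm y = norm x \<longrightarrow> f y = f x"
    using assms by blast
qed blast

definition potential_measure ::
    "'w measure \<Rightarrow> (real \<Rightarrow> 'w \<Rightarrow> 'a::euclidean_space) \<Rightarrow> 'a measure" where
  "potential_measure M X =
     measure_of UNIV (sets borel)
       (\<lambda>A. \<integral>\<^sup>+t\<in>{0..}. emeasure M {\<omega> \<in> space M. X t \<omega> \<in> A} \<partial>lborel)"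

text \<open>\<open>g\<close> is a density of the absolutely continuous part in the Lebesgue decomposition of
  \<open>N\<close>; \<open>N\<^sub>s\<close> is the singular part, carried by the Lebesgue null set \<open>S\<close>.\<close>

definition ac_part_density :: "'a::euclidean_space measure \<Rightarrow> ('a \<Rightarrow> real) \<Rightarrow> bool" where
  "ac_part_density N g \<longleftrightarrow>
     g \<in> borel_measurable borel \<and> (\<forall>x. 0 \<le> g x) \<and>
     (\<exists>N\<^sub>s. \<exists>S \<in> null_sets lborel. sets N\<^sub>s = sets borel \<and> emeasure N\<^sub>s (- S) = 0 \<and>
        (\<forall>A \<in> sets borel.
           emeasure N A = (\<integral>\<^sup>+x\<in>A. ennreal (g x) \<partial>lborel) + emeasure N\<^sub>s A))"

text \<open>The density is only determined almost everywhere; any radial, radially non-increasing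
  version is admitted. These versions can differ only on countably many spheres (and at the
  origin), and \<open>x \<mapsto> \<integral> p t x dt\<close> with jointly measurable, radially non-increasing transition densities
  \<open>p t\<close> is one of them.\<close>

definition potential_density ::
    "'w measure \<Rightarrow> (real \<Rightarrow> 'w \<Rightarrow> 'a::euclidean_space) \<Rightarrow> ('a \<Rightarrow> real) \<Rightarrow> bool" where
  "potential_density M X G \<longleftrightarrow>
     ac_part_density (potential_measure M X) G \<and> radially_nonincreasing G"

end

theory Submission
  imports Defs
begin

text \<open>
  Write \<open>p\<^sub>t\<close> for the law of \<open>X\<^sub>t\<close>, \<open>N\<close> for the potential measure, \<open>\<gamma>\<close> for the standard Gaussian law on the
  state space, \<open>d\<close> for the dimension and \<open>K\<close> for the constant in the limit; \<open>K |x|\<^bsup>\<alpha>-d\<^esup>\<close> is the Riesz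
  kernel, that is, the potential density of the process with exponent \<open>|\<xi>|\<^bsup>\<alpha>\<^esup>\<close>. The claim is that \<open>G\<close>,
  rescaled by \<open>r\<close> in space and by \<open>\<psi>(1/r)\<close> in time, converges to the Riesz kernel on the unit sphere.

  The potential is accessible through Gaussian test functions. Since \<open>exp (-|x|\<^sup>2/2)\<close> is the Fourier
  transform of \<open>\<gamma>\<close>, integrating it against \<open>p\<^sub>t\<close> and then over \<open>t\<close> gives
  \<open>\<integral> exp (-|l x|\<^sup>2/2) N(dx) = \<integral> 1/\<psi>(l z) \<gamma>(dz)\<close> (\<open>nn_integral_gaussian_potential\<close>). Put
  \<open>l = q/r\<close> with \<open>q\<close> fixed and multiply by \<open>\<psi>(1/r)\<close>: regular variation gives the pointwise limit
  \<open>(q |z|)\<^bsup>-\<alpha>\<^esup>\<close> of \<open>\<psi>(1/r)/\<psi>(q z/r)\<close>, and dominated convergence applies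
  (\<open>levy_exponent_ratio_limit\<close>). The dominating function does not come from Potter bounds but from
  unimodality, which forces \<open>\<psi>(l \<xi>) \<le> 18 max (1, l\<^sup>2) \<psi>(\<xi>)\<close> for all \<open>l\<close> (\<open>levy_exponent_growth\<close>).
  The ratio is therefore at most a multiple of \<open>1 + |z|\<^bsup>-2\<^esup>\<close>, which is integrable exactly because
  \<open>d \<ge> 3\<close>.

  Taking \<open>q\<^sup>2 = 1, 2, 3, \<dots>\<close> determines, in the variable \<open>u = exp (-|x|\<^sup>2/(2 r\<^sup>2)) \<in> [0,1]\<close>, the limits of
  all moments of the rescaled potential measure, and these limits are the moments of the Riesz kernel.
  As in Karamata's proof of the Tauberian theorem, Weierstrass approximation upgrades this to all
  continuous functions of \<open>u\<close> (\<open>scaled_potential_vague_limit\<close>).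

  Monotonicity of \<open>G\<close> turns this into a pointwise statement. Test with bumps supported in a shell
  \<open>s \<le> |y| \<le> t\<close>. If \<open>t = 1\<close>, the rescaled density is on the shell at least its value on the unit
  sphere; if \<open>s = 1\<close>, at most. The Riesz kernel varies little over a thin shell, so letting the shell
  shrink to the unit sphere from inside and from outside gives the upper and the lower bound.
\<close>

section \<open>Integrals of one minus cosine against unimodal measures\<close>

lemma one_minus_cos_le: "1 - cos y \<le> 2 * min 1 (y\<^sup>2)" for y :: real
proof -
  have "1 - cos y = 2 * (sin (y/2))\<^sup>2"
    using cos_double_sin[of "y/2"] by simp
  moreover have "(sin (y/2))\<^sup>2 \<le> (y/2)\<^sup>2"
    using abs_sin_x_le_abs_x[of "y/2"] by (metis abs_le_square_iff)
  moreover have "(sin (y/2))\<^sup>2 \<le> 1"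
    by (simp add: abs_square_le_1)
  moreover have "(y/2)\<^sup>2 \<le> y\<^sup>2"
    by (simp add: power_divide)
  ultimately show ?thesis
    by (auto simp: min_def)
qed

lemma square_le_one_minus_cos:
  assumes "\<bar>y\<bar> \<le> pi"
  shows "y\<^sup>2 \<le> 8 * (1 - cos y)"
proof -
  define u where "u = \<bar>y\<bar> / 2"
  have u: "0 \<le> u" "u \<le> pi / 2" using assms by (auto simp: u_def)
  have "pi / 2 < 1.7"
    using pi_approx by (simp add: field_simps)
  with u have "u\<^sup>2 \<le> (1.7)\<^sup>2"
    by (intro power_mono) auto
  then have u2: "u\<^sup>2 \<le> 3"
    by (simp add: power2_eq_square)
  have "\<bar>sin u - (\<Sum>m<3. sin_coeff m * u ^ m)\<bar> \<le> inverse (fact 3) * \<bar>u\<bar> ^ 3"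
    by (rule Maclaurin_sin_bound)
  moreover have "(\<Sum>m<3. sin_coeff m * u ^ m) = u"
    by (simp add: sin_coeff_def eval_nat_numeral)
  moreover have "inverse (fact 3) * \<bar>u\<bar> ^ 3 = u * u\<^sup>2 / 6"
    using u by (simp add: eval_nat_numeral)
  ultimately have "\<bar>sin u - u\<bar> \<le> u * u\<^sup>2 / 6"
    by simp
  then have "u - u * u\<^sup>2 / 6 \<le> sin u"
    by linarith
  moreover have "u * u\<^sup>2 \<le> u * 3"
    using u u2 by (intro mult_left_mono) auto
  ultimately have "u / 2 \<le> sin u"
    by simp
  then have "(u/2)\<^sup>2 \<le> (sin u)\<^sup>2"
    using u by (intro power_mono) auto
  moreover have "1 - cos y = 2 * (sin u)\<^sup>2"
    using cos_double_sin[of u] by (simp add: u_def)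
  ultimately show ?thesis
    by (simp add: u_def power_divide)
qed

text \<open>
  An isotropic unimodal measure may have an atom at the origin, and so may the potential measure.
  Test functions that vanish at the origin do not see the atom, so they can be integrated against
  the density alone.
\<close>

lemma nn_integral_vanishing_at_0:
  fixes \<mu> :: "'a::euclidean_space measure"
  assumes [measurable_cong]: "sets \<mu> = sets borel"
    and [measurable]: "g \<in> borel_measurable borel" "f \<in> borel_measurable borel"
    and \<mu>: "\<And>A. A \<in> sets borel \<Longrightarrow> 0 \<notin> A \<Longrightarrow>
           emeasure \<mu> A = (\<integral>\<^sup>+x\<in>A. ennreal (g x) \<partial>lborel)"
    and "f 0 = 0"
  shows "(\<integral>\<^sup>+x. f x \<partial>\<mu>) = (\<integral>\<^sup>+x. f x * ennreal (g x) \<partial>lborel)"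
proof -
  let ?I = "indicator (- {0}) :: 'a \<Rightarrow> ennreal"
  have eq: "density \<mu> ?I = density lborel (\<lambda>x. ennreal (g x) * ?I x)"
  proof (rule measure_eqI)
    fix A assume "A \<in> sets (density \<mu> ?I)"
    then have A[measurable]: "A \<in> sets borel" by (simp add: assms(1))
    have "emeasure (density \<mu> ?I) A = emeasure \<mu> (A - {0})"
      by (subst emeasure_density)
        (auto simp: assms(1) simp flip: nn_integral_indicator intro!: nn_integral_cong split: split_indicator)
    also have "\<dots> = emeasure (density lborel (\<lambda>x. ennreal (g x) * ?I x)) A"
      by (subst \<mu>) (auto simp: emeasure_density intro!: nn_integral_cong split: split_indicator)
    finally show "emeasure (density \<mu> ?I) A = emeasure (density lborel (\<lambda>x. ennreal (g x) * ?I x)) A" .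
  qed (simp add: assms(1))
  have "(\<integral>\<^sup>+x. f x \<partial>\<mu>) = (\<integral>\<^sup>+x. f x \<partial>density \<mu> ?I)"
    by (subst nn_integral_density) (auto simp: \<open>f 0 = 0\<close> intro!: nn_integral_cong split: split_indicator)
  also have "\<dots> = (\<integral>\<^sup>+x. f x * ennreal (g x) \<partial>lborel)"
    unfolding eq
    by (subst nn_integral_density)
      (auto simp: \<open>f 0 = 0\<close> ac_simps intro!: nn_integral_cong split: split_indicator)
  finally show ?thesis .
qed

lemma nn_integral_lborel_shift:
  fixes f :: "'a::euclidean_space \<Rightarrow> ennreal"
  assumes [measurable]: "f \<in> borel_measurable borel"
  shows "(\<integral>\<^sup>+x. f (x + h) \<partial>lborel) = (\<integral>\<^sup>+x. f x \<partial>lborel)"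
proof -
  have "(\<integral>\<^sup>+x. f x \<partial>lborel) = (\<integral>\<^sup>+x. f x \<partial>distr lborel borel ((+) h))"
    by (simp add: lborel_distr_plus)
  then show ?thesis by (simp add: nn_integral_distr add.commute)
qed

text \<open>
  Shifting by half a period \<open>h\<close> of \<open>cos (\<xi> \<bullet> x)\<close> towards the origin exchanges \<open>1 + cos\<close> and \<open>1 - cos\<close> and
  can only increase \<open>g\<close>. Hence the integral of \<open>(1 + cos) g\<close> over \<open>\<xi> \<bullet> x > pi\<close>, like that of
  \<open>(1 - cos) g\<close>, is at most the right-hand side; the two add up to twice the left-hand side.
\<close>

lemma radially_nonincreasing_half_space_bound:
  fixes g :: "'a::euclidean_space \<Rightarrow> real" and \<xi> :: 'a
  assumes [measurable]: "g \<in> borel_measurable borel"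
    and g0: "\<And>x. 0 \<le> g x" and g: "radially_nonincreasing g" and "\<xi> \<noteq> 0"
  shows "(\<integral>\<^sup>+x. ennreal (of_bool (\<xi> \<bullet> x > pi) * g x) \<partial>lborel)
     \<le> (\<integral>\<^sup>+x. ennreal (of_bool (\<xi> \<bullet> x > 0) * (1 - cos (\<xi> \<bullet> x)) * g x) \<partial>lborel)"
    (is "?L \<le> ?R")
proof -
  \<comment> \<open>half a period: \<open>cos (\<xi> \<bullet> (x + h)) = - cos (\<xi> \<bullet> x)\<close>\<close>
  define h where "h = (pi / (\<xi> \<bullet> \<xi>)) *\<^sub>R \<xi>"
  have \<xi>h: "\<xi> \<bullet> h = pi" using \<open>\<xi> \<noteq> 0\<close> by (simp add: h_def)
  have mono: "g (x + h) \<le> g x" if "\<xi> \<bullet> x > 0" for x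
  proof -
    have "x \<noteq> 0" using that by auto
    moreover have "norm x \<le> norm (x + h)"
    proof -
      have "x \<bullet> h \<ge> 0" using that by (simp add: h_def inner_commute)
      then have "(norm x)\<^sup>2 \<le> (norm (x + h))\<^sup>2"
        by (simp add: power2_norm_eq_inner inner_add_left inner_add_right inner_commute)
      then show ?thesis by (rule power2_le_imp_le) simp
    qed
    ultimately show ?thesis using g unfolding radially_nonincreasing_def by blast
  qed
  have "(\<integral>\<^sup>+x. ennreal (of_bool (\<xi> \<bullet> x > pi) * (1 + cos (\<xi> \<bullet> x)) * g x) \<partial>lborel)
      = (\<integral>\<^sup>+x. ennreal (of_bool (\<xi> \<bullet> (x + h) > pi) * (1 + cos (\<xi> \<bullet> (x + h))) * g (x + h)) \<partial>lborel)"
    by (rule nn_integral_lborel_shift[symmetric, where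
          f = "\<lambda>x. ennreal (of_bool (\<xi> \<bullet> x > pi) * (1 + cos (\<xi> \<bullet> x)) * g x)"]) measurable
  also have "\<dots> \<le> ?R"
  proof (rule nn_integral_mono, rule ennreal_leI)
    fix x
    show "of_bool (\<xi> \<bullet> (x + h) > pi) * (1 + cos (\<xi> \<bullet> (x + h))) * g (x + h)
       \<le> of_bool (\<xi> \<bullet> x > 0) * (1 - cos (\<xi> \<bullet> x)) * g x"
      using mono[of x] by (auto simp: inner_add_right \<xi>h intro!: mult_left_mono)
  qed
  finally have 1: "(\<integral>\<^sup>+x. ennreal (of_bool (\<xi> \<bullet> x > pi) * (1 + cos (\<xi> \<bullet> x)) * g x) \<partial>lborel) \<le> ?R" .
  have 2: "(\<integral>\<^sup>+x. ennreal (of_bool (\<xi> \<bullet> x > pi) * (1 - cos (\<xi> \<bullet> x)) * g x) \<partial>lborel) \<le> ?R"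
  proof (rule nn_integral_mono, rule ennreal_leI)
    fix x
    show "of_bool (\<xi> \<bullet> x > pi) * (1 - cos (\<xi> \<bullet> x)) * g x \<le> of_bool (\<xi> \<bullet> x > 0) * (1 - cos (\<xi> \<bullet> x)) * g x"
      using g0[of x] less_trans[OF pi_gt_zero, of "\<xi> \<bullet> x"] by auto
  qed
  have "2 * ?L = (\<integral>\<^sup>+x. ennreal (of_bool (\<xi> \<bullet> x > pi) * (1 + cos (\<xi> \<bullet> x)) * g x)
        + ennreal (of_bool (\<xi> \<bullet> x > pi) * (1 - cos (\<xi> \<bullet> x)) * g x) \<partial>lborel)"
  proof (subst nn_integral_cmult[symmetric], measurable, rule nn_integral_cong)
    fix x
    let ?b = "of_bool (\<xi> \<bullet> x > pi) :: real"
    have "0 \<le> 1 + cos (\<xi> \<bullet> x)" using cos_ge_minus_one[of "\<xi> \<bullet> x"] by linarith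
    then have "ennreal (?b * (1 + cos (\<xi> \<bullet> x)) * g x) + ennreal (?b * (1 - cos (\<xi> \<bullet> x)) * g x)
        = ennreal (?b * (1 + cos (\<xi> \<bullet> x)) * g x + ?b * (1 - cos (\<xi> \<bullet> x)) * g x)"
      by (intro ennreal_plus[symmetric] mult_nonneg_nonneg g0) auto
    also have "?b * (1 + cos (\<xi> \<bullet> x)) * g x + ?b * (1 - cos (\<xi> \<bullet> x)) * g x = 2 * (?b * g x)"
      by (simp add: algebra_simps)
    also have "ennreal (2 * (?b * g x)) = 2 * ennreal (?b * g x)"
      using g0[of x] by (simp add: ennreal_mult)
    finally show "2 * ennreal (?b * g x) =
      ennreal (?b * (1 + cos (\<xi> \<bullet> x)) * g x) + ennreal (?b * (1 - cos (\<xi> \<bullet> x)) * g x)" ..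
  qed
  also have "\<dots> \<le> ?R + ?R"
    by (subst nn_integral_add) (use 1 2 in \<open>auto intro!: add_mono\<close>)
  finally have "2 * ?L \<le> 2 * ?R" by (simp add: mult_2)
  then show ?thesis
    by (subst (asm) ennreal_mult_le_mult_iff) auto
qed

text \<open>
  The reverse of \<open>1 - cos y \<le> 2 min (1, y\<^sup>2)\<close> fails pointwise, because \<open>1 - cos\<close> vanishes at nonzero
  multiples of the period. It holds after integration against a unimodal measure: for
  \<open>|\<xi> \<bullet> x| \<le> pi\<close> the pointwise bound is good enough, and the two half spaces beyond are covered by
  the shift argument.
\<close>

lemma unimodal_truncated_second_moment_le:
  fixes \<mu> :: "'a::euclidean_space measure"
  assumes "isotropic_unimodal_measure \<mu>"
  shows "(\<integral>\<^sup>+x. ennreal (min 1 ((\<xi> \<bullet> x)\<^sup>2)) \<partial>\<mu>)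
     \<le> 9 * (\<integral>\<^sup>+x. ennreal (1 - cos (\<xi> \<bullet> x)) \<partial>\<mu>)"
proof (cases "\<xi> = 0")
  case False
  obtain g where sets: "sets \<mu> = sets borel" and g[measurable]: "g \<in> borel_measurable borel"
    and g0: "\<And>x. 0 \<le> g x" and gn: "radially_nonincreasing g"
    and \<mu>: "\<And>A. A \<in> sets borel \<Longrightarrow> 0 \<notin> A \<Longrightarrow> emeasure \<mu> A = (\<integral>\<^sup>+x\<in>A. ennreal (g x) \<partial>lborel)"
    using assms unfolding isotropic_unimodal_measure_def by blast
  note to_lborel = nn_integral_vanishing_at_0[OF sets g _ \<mu>]
  let ?w = "\<lambda>x. (1 - cos (\<xi> \<bullet> x)) * g x"
  have w0: "0 \<le> ?w x" for x using g0[of x] by simp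
  have "(\<integral>\<^sup>+x. ennreal (min 1 ((\<xi> \<bullet> x)\<^sup>2)) \<partial>\<mu>) = (\<integral>\<^sup>+x. ennreal (min 1 ((\<xi> \<bullet> x)\<^sup>2)) * ennreal (g x) \<partial>lborel)"
    by (rule to_lborel) auto
  also have "\<dots> \<le> (\<integral>\<^sup>+x. ennreal (of_bool (\<xi> \<bullet> x > pi) * g x) + ennreal (of_bool (-\<xi> \<bullet> x > pi) * g x)
     + 8 * ennreal (?w x) \<partial>lborel)"
  proof (rule nn_integral_mono)
    fix x
    have "min 1 ((\<xi> \<bullet> x)\<^sup>2) * g x \<le>
      of_bool (\<xi> \<bullet> x > pi) * g x + of_bool (-\<xi> \<bullet> x > pi) * g x + 8 * ?w x"
    proof (cases "\<bar>\<xi> \<bullet> x\<bar> \<le> pi")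
      case True
      have "min 1 ((\<xi> \<bullet> x)\<^sup>2) \<le> 8 * (1 - cos (\<xi> \<bullet> x))"
        using square_le_one_minus_cos[OF True] by simp
      then have "min 1 ((\<xi> \<bullet> x)\<^sup>2) * g x \<le> 8 * (1 - cos (\<xi> \<bullet> x)) * g x"
        by (intro mult_right_mono g0)
      moreover have "of_bool (\<xi> \<bullet> x > pi) * g x + of_bool (-\<xi> \<bullet> x > pi) * g x \<ge> 0"
        by (intro add_nonneg_nonneg mult_nonneg_nonneg g0) auto
      ultimately show ?thesis by linarith
    next
      case False
      have "min 1 ((\<xi> \<bullet> x)\<^sup>2) * g x \<le> 1 * g x"
        by (intro mult_right_mono g0) auto
      moreover from False have "\<xi> \<bullet> x > pi \<or> -\<xi> \<bullet> x > pi" by auto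
      then have "g x \<le> of_bool (\<xi> \<bullet> x > pi) * g x + of_bool (-\<xi> \<bullet> x > pi) * g x"
        using g0[of x] by auto
      ultimately show ?thesis using w0[of x] by simp
    qed
    then have "ennreal (min 1 ((\<xi> \<bullet> x)\<^sup>2) * g x) \<le> ennreal (of_bool (\<xi> \<bullet> x > pi) * g x + of_bool (-\<xi> \<bullet> x > pi) * g x + 8 * ?w x)"
      by (rule ennreal_leI)
    then show "ennreal (min 1 ((\<xi> \<bullet> x)\<^sup>2)) * ennreal (g x) \<le> ennreal (of_bool (\<xi> \<bullet> x > pi) * g x)
       + ennreal (of_bool (-\<xi> \<bullet> x > pi) * g x) + 8 * ennreal (?w x)"
      using g0[of x] w0[of x] by (simp add: ennreal_mult ennreal_plus)
  qed
  also have "\<dots> = (\<integral>\<^sup>+x. ennreal (of_bool (\<xi> \<bullet> x > pi) * g x) \<partial>lborel)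
       + (\<integral>\<^sup>+x. ennreal (of_bool (-\<xi> \<bullet> x > pi) * g x) \<partial>lborel)
       + 8 * (\<integral>\<^sup>+x. ennreal (?w x) \<partial>lborel)"
    by (simp add: nn_integral_add nn_integral_cmult)
  also have "\<dots> \<le> (\<integral>\<^sup>+x. ennreal (of_bool (\<xi> \<bullet> x > 0) * (1 - cos (\<xi> \<bullet> x)) * g x) \<partial>lborel)
     + (\<integral>\<^sup>+x. ennreal (of_bool (-\<xi> \<bullet> x > 0) * (1 - cos (-\<xi> \<bullet> x)) * g x) \<partial>lborel)
       + 8 * (\<integral>\<^sup>+x. ennreal (?w x) \<partial>lborel)"
    using False by (intro add_mono radially_nonincreasing_half_space_bound[OF g g0 gn]) auto
  also have "\<dots> = (\<integral>\<^sup>+x. ennreal (of_bool (\<xi> \<bullet> x > 0) * (1 - cos (\<xi> \<bullet> x)) * g x)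
     + ennreal (of_bool (-\<xi> \<bullet> x > 0) * (1 - cos (-\<xi> \<bullet> x)) * g x) \<partial>lborel)
       + 8 * (\<integral>\<^sup>+x. ennreal (?w x) \<partial>lborel)"
    by (subst nn_integral_add) auto
  also have "\<dots> \<le> (\<integral>\<^sup>+x. ennreal (?w x) \<partial>lborel) + 8 * (\<integral>\<^sup>+x. ennreal (?w x) \<partial>lborel)"
    using w0 by (intro add_right_mono nn_integral_mono) auto
  also have "\<dots> = 9 * (\<integral>\<^sup>+x. ennreal (?w x) \<partial>lborel)"
    using distrib_right[of 1 8 "\<integral>\<^sup>+x. ennreal (?w x) \<partial>lborel"] by simp
  also have "(\<integral>\<^sup>+x. ennreal (?w x) \<partial>lborel) = (\<integral>\<^sup>+x. ennreal (1 - cos (\<xi> \<bullet> x)) * ennreal (g x) \<partial>lborel)"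
    using g0 by (simp add: ennreal_mult)
  also have "\<dots> = (\<integral>\<^sup>+x. ennreal (1 - cos (\<xi> \<bullet> x)) \<partial>\<mu>)"
    by (rule to_lborel[symmetric]) auto
  finally show ?thesis .
qed simp

text \<open>
  Up to constants the integral of \<open>1 - cos (\<xi> \<bullet> x)\<close> is that of \<open>min (1, (\<xi> \<bullet> x)\<^sup>2)\<close>, for which the
  dependence on the length of \<open>\<xi>\<close> is plain.
\<close>

lemma unimodal_one_minus_cos_growth:
  fixes \<mu> :: "'a::euclidean_space measure"
  assumes "isotropic_unimodal_measure \<mu>"
  shows "(\<integral>\<^sup>+x. ennreal (1 - cos ((l *\<^sub>R \<xi>) \<bullet> x)) \<partial>\<mu>)
     \<le> ennreal (18 * max 1 (l\<^sup>2)) * (\<integral>\<^sup>+x. ennreal (1 - cos (\<xi> \<bullet> x)) \<partial>\<mu>)"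
proof -
  have [measurable_cong]: "sets \<mu> = sets borel"
    using assms unfolding isotropic_unimodal_measure_def by blast
  have "(\<integral>\<^sup>+x. ennreal (1 - cos ((l *\<^sub>R \<xi>) \<bullet> x)) \<partial>\<mu>)
     \<le> (\<integral>\<^sup>+x. ennreal (2 * max 1 (l\<^sup>2)) * ennreal (min 1 ((\<xi> \<bullet> x)\<^sup>2)) \<partial>\<mu>)"
  proof (rule nn_integral_mono)
    fix x
    have "1 - cos ((l *\<^sub>R \<xi>) \<bullet> x) \<le> 2 * min 1 (l\<^sup>2 * (\<xi> \<bullet> x)\<^sup>2)"
      using one_minus_cos_le[of "(l *\<^sub>R \<xi>) \<bullet> x"] by (simp add: power_mult_distrib)
    also have "min 1 (l\<^sup>2 * (\<xi> \<bullet> x)\<^sup>2) \<le> max 1 (l\<^sup>2) * min 1 ((\<xi> \<bullet> x)\<^sup>2)"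
    proof (cases "(\<xi> \<bullet> x)\<^sup>2 \<le> 1")
      case True
      have "l\<^sup>2 * (\<xi> \<bullet> x)\<^sup>2 \<le> max 1 (l\<^sup>2) * (\<xi> \<bullet> x)\<^sup>2"
        by (intro mult_right_mono) auto
      with True show ?thesis by (simp add: min_def)
    qed (auto simp: min_def)
    finally show "ennreal (1 - cos ((l *\<^sub>R \<xi>) \<bullet> x))
       \<le> ennreal (2 * max 1 (l\<^sup>2)) * ennreal (min 1 ((\<xi> \<bullet> x)\<^sup>2))"
      by (simp add: ennreal_leI mult.assoc flip: ennreal_mult)
  qed
  also have "\<dots> = ennreal (2 * max 1 (l\<^sup>2)) * (\<integral>\<^sup>+x. ennreal (min 1 ((\<xi> \<bullet> x)\<^sup>2)) \<partial>\<mu>)"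
    by (rule nn_integral_cmult) measurable
  also have "\<dots> \<le> ennreal (2 * max 1 (l\<^sup>2)) * (9 * (\<integral>\<^sup>+x. ennreal (1 - cos (\<xi> \<bullet> x)) \<partial>\<mu>))"
    by (intro mult_left_mono unimodal_truncated_second_moment_le assms) auto
  also have "\<dots> = ennreal (2 * max 1 (l\<^sup>2)) * ennreal 9 * (\<integral>\<^sup>+x. ennreal (1 - cos (\<xi> \<bullet> x)) \<partial>\<mu>)"
    by (simp add: mult.assoc)
  also have "ennreal (2 * max 1 (l\<^sup>2)) * ennreal 9 = ennreal (18 * max 1 (l\<^sup>2))"
    by (subst ennreal_mult[symmetric]) auto
  finally show ?thesis .
qed

section \<open>Growth of the exponent\<close>

lemma isotropic_unimodal_levy_processD:
  assumes "isotropic_unimodal_levy_process M X"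
  shows "levy_process M X"
    and "t \<ge> 0 \<Longrightarrow> prob_space (distr M borel (X t))"
    and "t \<ge> 0 \<Longrightarrow> rotation_invariant (distr M borel (X t))"
    and "t > 0 \<Longrightarrow> isotropic_unimodal_measure (distr M borel (X t))"
proof -
  show levy: "levy_process M X"
    using assms
    by (simp add: isotropic_unimodal_levy_process_def isotropic_levy_process_def)
  show "t \<ge> 0 \<Longrightarrow> prob_space (distr M borel (X t))"
    using levy unfolding levy_process_def by (intro prob_space.prob_space_distr) auto
  show "t \<ge> 0 \<Longrightarrow> rotation_invariant (distr M borel (X t))"
    and "t > 0 \<Longrightarrow> isotropic_unimodal_measure (distr M borel (X t))"
    using assms
    by (simp_all add: isotropic_unimodal_levy_process_def isotropic_levy_process_def)
qed

lemma integral_cos_eq_exp: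
  assumes "isotropic_unimodal_levy_process M X" "levy_khintchine_exponent M X \<psi>" "t \<ge> 0"
  shows "(LINT x|distr M borel (X t). cos (\<xi> \<bullet> x)) = exp (- t * \<psi> \<xi>)"
proof -
  interpret p: prob_space "distr M borel (X t)"
    by (rule isotropic_unimodal_levy_processD(2)[OF assms(1,3)])
  have int: "integrable (distr M borel (X t)) (\<lambda>x. iexp (\<xi> \<bullet> x))"
    by (rule p.integrable_const_bound[where B = 1]) (auto simp del: of_real_mult)
  have "(LINT x|distr M borel (X t). cos (\<xi> \<bullet> x)) = (LINT x|distr M borel (X t). Re (iexp (\<xi> \<bullet> x)))"
    by (simp add: Re_exp)
  also have "\<dots> = Re (CLINT x|distr M borel (X t). iexp (\<xi> \<bullet> x))"
    by (rule integral_Re[OF int])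
  also have "\<dots> = exp (- t * \<psi> \<xi>)"
    using assms(2,3) unfolding levy_khintchine_exponent_def
    by (metis Re_complex_of_real)
  finally show ?thesis .
qed

lemma nn_integral_one_minus_cos:
  assumes "isotropic_unimodal_levy_process M X" "levy_khintchine_exponent M X \<psi>" "t \<ge> 0"
  shows "(\<integral>\<^sup>+x. ennreal (1 - cos (\<xi> \<bullet> x)) \<partial>distr M borel (X t)) = ennreal (1 - exp (- t * \<psi> \<xi>))"
    and "0 \<le> 1 - exp (- t * \<psi> \<xi>)"
proof -
  interpret p: prob_space "distr M borel (X t)"
    by (rule isotropic_unimodal_levy_processD(2)[OF assms(1,3)])
  have int: "integrable (distr M borel (X t)) (\<lambda>x. cos (\<xi> \<bullet> x))"
    by (rule p.integrable_const_bound[where B = 1]) auto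
  have eq: "(LINT x|distr M borel (X t). 1 - cos (\<xi> \<bullet> x)) = 1 - exp (- t * \<psi> \<xi>)"
    using int p.prob_space integral_cos_eq_exp[OF assms] by simp
  show "0 \<le> 1 - exp (- t * \<psi> \<xi>)"
    unfolding eq[symmetric] by (rule integral_nonneg_AE) auto
  show "(\<integral>\<^sup>+x. ennreal (1 - cos (\<xi> \<bullet> x)) \<partial>distr M borel (X t)) = ennreal (1 - exp (- t * \<psi> \<xi>))"
    unfolding eq[symmetric] using int by (intro nn_integral_eq_integral) auto
qed

lemma levy_exponent_nonneg:
  assumes "isotropic_unimodal_levy_process M X" "levy_khintchine_exponent M X \<psi>"
  shows "0 \<le> \<psi> \<xi>"
  using nn_integral_one_minus_cos(2)[OF assms, of 1 \<xi>] by simp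

lemma levy_exponent_measurable:
  assumes "isotropic_unimodal_levy_process M X" "levy_khintchine_exponent M X \<psi>"
  shows "\<psi> \<in> borel_measurable borel"
proof -
  interpret p: prob_space "distr M borel (X 1)"
    by (rule isotropic_unimodal_levy_processD(2)[OF assms(1)]) simp
  have "\<psi> \<xi> = - ln (LINT x|distr M borel (X 1). cos (\<xi> \<bullet> x))" for \<xi>
    using integral_cos_eq_exp[OF assms, of 1 \<xi>] by simp
  then have "\<psi> = (\<lambda>\<xi>. - ln (LINT x|distr M borel (X 1). cos (\<xi> \<bullet> x)))" by blast
  also have "\<dots> \<in> borel_measurable borel"
    by measurable
  finally show ?thesis .
qed

text \<open>
  This contains two facts: for \<open>l \<le> 1\<close> that \<open>\<psi>\<close> is increasing up to a constant along rays, and for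
  \<open>l \<ge> 1\<close> that it grows at most quadratically. The bound holds for \<open>1 - exp (- t * \<psi>)\<close>, which is the
  integral of \<open>1 - cos\<close> against the law at time \<open>t\<close>, and passes to \<open>\<psi>\<close> as \<open>t\<close> tends to zero.
\<close>

lemma levy_exponent_growth:
  assumes "isotropic_unimodal_levy_process M X" "levy_khintchine_exponent M X \<psi>"
  shows "\<psi> (l *\<^sub>R \<xi>) \<le> 18 * max 1 (l\<^sup>2) * \<psi> \<xi>"
proof -
  define C where "C = 18 * max 1 (l\<^sup>2)"
  have "C \<ge> 0" by (simp add: C_def)
  have bound: "\<psi> (l *\<^sub>R \<xi>) \<le> exp (t * \<psi> (l *\<^sub>R \<xi>)) * (C * \<psi> \<xi>)" if "t > 0" for t
  proof -
    note nn = nn_integral_one_minus_cos[OF assms less_imp_le[OF that]]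
    \<comment> \<open>multiplied by \<open>exp (t * \<psi> (l *\<^sub>R \<xi>))\<close>, the left-hand side becomes \<open>exp (t * \<psi> (l *\<^sub>R \<xi>)) - 1\<close>, which is at least linear in \<open>t\<close>\<close>
    have "ennreal (1 - exp (- t * \<psi> (l *\<^sub>R \<xi>))) \<le> ennreal C * ennreal (1 - exp (- t * \<psi> \<xi>))"
      using unimodal_one_minus_cos_growth[OF isotropic_unimodal_levy_processD(4)[OF assms(1) that], of l \<xi>]
      unfolding nn(1) C_def .
    then have "1 - exp (- t * \<psi> (l *\<^sub>R \<xi>)) \<le> C * (1 - exp (- t * \<psi> \<xi>))"
      using nn(2)[of \<xi>] \<open>C \<ge> 0\<close> by (simp add: ennreal_le_iff flip: ennreal_mult)
    also have "\<dots> \<le> C * (t * \<psi> \<xi>)"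
      using exp_ge_add_one_self[of "- t * \<psi> \<xi>"] \<open>C \<ge> 0\<close> by (intro mult_left_mono) auto
    finally have "exp (t * \<psi> (l *\<^sub>R \<xi>)) * (1 - exp (- t * \<psi> (l *\<^sub>R \<xi>)))
        \<le> exp (t * \<psi> (l *\<^sub>R \<xi>)) * (C * (t * \<psi> \<xi>))"
      by (intro mult_left_mono) auto
    moreover have "exp (t * \<psi> (l *\<^sub>R \<xi>)) * (1 - exp (- t * \<psi> (l *\<^sub>R \<xi>))) = exp (t * \<psi> (l *\<^sub>R \<xi>)) - 1"
      by (simp add: right_diff_distrib flip: exp_add)
    moreover have "t * \<psi> (l *\<^sub>R \<xi>) \<le> exp (t * \<psi> (l *\<^sub>R \<xi>)) - 1"
      using exp_ge_add_one_self[of "t * \<psi> (l *\<^sub>R \<xi>)"] by linarith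
    ultimately have "t * \<psi> (l *\<^sub>R \<xi>) \<le> exp (t * \<psi> (l *\<^sub>R \<xi>)) * (C * (t * \<psi> \<xi>))"
      by linarith
    then have "t * \<psi> (l *\<^sub>R \<xi>) \<le> t * (exp (t * \<psi> (l *\<^sub>R \<xi>)) * (C * \<psi> \<xi>))"
      by (simp only: ac_simps)
    then show ?thesis using that by simp
  qed
  have "((\<lambda>t. exp (t * \<psi> (l *\<^sub>R \<xi>)) * (C * \<psi> \<xi>)) \<longlongrightarrow> exp (0 * \<psi> (l *\<^sub>R \<xi>)) * (C * \<psi> \<xi>)) (at_right 0)"
    by (intro tendsto_intros)
  then have "((\<lambda>t. exp (t * \<psi> (l *\<^sub>R \<xi>)) * (C * \<psi> \<xi>)) \<longlongrightarrow> C * \<psi> \<xi>) (at_right 0)"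
    by simp
  then show ?thesis
    unfolding C_def[symmetric]
    by (rule tendsto_lowerbound)
      (auto intro: eventually_mono[OF eventually_at_right_less[of "0::real"] bound])
qed

lemma reflection_exists:
  fixes a b :: "'a::euclidean_space"
  assumes "norm a = norm b"
  obtains T where "orthogonal_transformation T" "T a = b" "\<And>x y. T x \<bullet> y = x \<bullet> T y"
proof (cases "a = b")
  case True
  then show ?thesis
    by (intro that[of "\<lambda>x. x"]) auto
next
  case False
  define v where "v = a - b"
  define T where "T = (\<lambda>x. x - (2 * (x \<bullet> v) / (v \<bullet> v)) *\<^sub>R v)"
  have v: "v \<bullet> v \<noteq> 0" using False by (simp add: v_def)
  have "linear T"
    unfolding T_def
    by (rule linearI) (auto simp: algebra_simps inner_add_left add_divide_distrib)
  moreover have "T x \<bullet> T y = x \<bullet> y" for x y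
    using v by (simp add: T_def inner_diff_left inner_diff_right inner_commute field_simps)
  ultimately have "orthogonal_transformation T"
    by (simp add: orthogonal_transformation_def)
  moreover have "T a = b"
  proof -
    have "a \<bullet> a = b \<bullet> b" using assms by (simp add: norm_eq)
    then have "2 * (a \<bullet> v) = v \<bullet> v"
      by (simp add: v_def inner_diff_left inner_diff_right inner_commute)
    then have "T a = a - v"
      using v by (simp add: T_def)
    then show ?thesis by (simp add: v_def)
  qed
  moreover have "T x \<bullet> y = x \<bullet> T y" for x y
    by (simp add: T_def inner_diff_left inner_diff_right inner_commute)
  ultimately show ?thesis by (rule that)
qed

text \<open>
  Self-adjointness of the reflection that swaps \<open>\<xi>\<close> and \<open>\<eta>\<close> moves it from the law to the frequency.
\<close>

lemma levy_exponent_radial: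
  assumes "isotropic_unimodal_levy_process M X" "levy_khintchine_exponent M X \<psi>"
    and "norm \<xi> = norm \<eta>"
  shows "\<psi> \<xi> = \<psi> \<eta>"
proof -
  obtain T where T: "orthogonal_transformation T" "T \<xi> = \<eta>" "\<And>x y. T x \<bullet> y = x \<bullet> T y"
    using reflection_exists[OF assms(3)] by blast
  have [measurable]: "T \<in> borel_measurable borel"
    by (intro borel_measurable_continuous_onI linear_continuous_on linear_conv_bounded_linear[THEN iffD1]
      orthogonal_transformation_linear T)
  let ?p = "distr M borel (X 1)"
  have "distr ?p borel T = ?p"
    using isotropic_unimodal_levy_processD(3)[OF assms(1), of 1] T(1)
    unfolding rotation_invariant_def by simp
  then have "exp (- 1 * \<psi> \<xi>) = (LINT x|distr ?p borel T. cos (\<xi> \<bullet> x))"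
    by (simp add: integral_cos_eq_exp[OF assms(1,2)])
  also have "\<dots> = (LINT x|?p. cos (\<xi> \<bullet> T x))"
    by (rule integral_distr) measurable
  also have "\<dots> = exp (- 1 * \<psi> \<eta>)"
    by (subst integral_cos_eq_exp[OF assms(1,2), symmetric]) (simp_all add: T(2) flip: T(3))
  finally show ?thesis by simp
qed

section \<open>Gaussian and radial integrals\<close>

definition std_gaussian :: "'a::euclidean_space measure" where
  "std_gaussian =
     density lborel (\<lambda>z. ennreal ((2 * pi) powr (- real DIM('a) / 2) * exp (- (norm z)\<^sup>2 / 2)))"

lemma sets_std_gaussian [simp, measurable_cong]: "sets std_gaussian = sets borel"
  by (simp add: std_gaussian_def)

lemma space_std_gaussian [simp]: "space std_gaussian = UNIV"
  by (simp add: std_gaussian_def)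

lemma std_gaussian_eq_prod:
  "(std_gaussian :: 'a::euclidean_space measure) =
     density lborel (\<lambda>z. ennreal (\<Prod>b\<in>Basis. std_normal_density (z \<bullet> b)))"
proof -
  have "(2 * pi) powr (- real DIM('a) / 2) * exp (- (norm z)\<^sup>2 / 2)
      = (\<Prod>b\<in>Basis. std_normal_density (z \<bullet> b))" for z :: 'a
  proof -
    have "(\<Prod>b\<in>Basis. std_normal_density (z \<bullet> b))
        = (1 / sqrt (2 * pi)) ^ DIM('a) * exp (\<Sum>b\<in>Basis. - (z \<bullet> b)\<^sup>2 / 2)"
      by (simp add: std_normal_density_def prod.distrib exp_sum prod_dividef power_divide)
    also have "(\<Sum>b\<in>Basis. - (z \<bullet> b)\<^sup>2 / 2) = - (norm z)\<^sup>2 / 2"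
      unfolding power2_norm_eq_inner euclidean_inner[of z z]
      by (simp add: sum_negf power2_eq_square flip: sum_divide_distrib)
    also have "(1 / sqrt (2 * pi)) ^ DIM('a) = (2 * pi) powr (- real DIM('a) / 2)"
    proof -
      have "1 / sqrt (2 * pi) = (2 * pi) powr (-1/2)"
        by (simp add: powr_minus_divide powr_half_sqrt)
      then have "(1 / sqrt (2 * pi)) ^ DIM('a) = ((2 * pi) powr (-1/2)) powr real DIM('a)"
        by (simp add: powr_realpow)
      then show ?thesis by (simp add: powr_powr)
    qed
    finally show ?thesis by simp
  qed
  then show ?thesis by (simp add: std_gaussian_def)
qed

lemma lborel_integral_prod:
  fixes f :: "'a::euclidean_space \<Rightarrow> real \<Rightarrow> complex"
  assumes int: "\<And>b. b \<in> Basis \<Longrightarrow> integrable lborel (f b)"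
  shows "(\<integral>z. (\<Prod>b\<in>Basis. f b (z \<bullet> b)) \<partial>lborel) = (\<Prod>b\<in>Basis. (\<integral>x. f b x \<partial>lborel))"
    and "integrable lborel (\<lambda>z. \<Prod>b\<in>Basis. f b (z \<bullet> b))"
proof -
  interpret product_sigma_finite "\<lambda>_::'a. lborel :: real measure" ..
  have [measurable]: "f b \<in> borel_measurable borel" if "b \<in> Basis" for b
    using borel_measurable_integrable[OF int[OF that]] by simp
  have eq: "(\<Prod>b\<in>Basis. f b ((\<Sum>c\<in>Basis. y c *\<^sub>R c) \<bullet> b)) = (\<Prod>b\<in>Basis. f b (y b))" for y
    by (intro prod.cong refl) simp
  show "(\<integral>z. (\<Prod>b\<in>Basis. f b (z \<bullet> b)) \<partial>lborel) = (\<Prod>b\<in>Basis. (\<integral>x. f b x \<partial>lborel))"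
    by (subst lborel_eq, subst integral_distr)
      (auto simp: eq int intro!: product_integral_prod)
  show "integrable lborel (\<lambda>z. \<Prod>b\<in>Basis. f b (z \<bullet> b))"
    by (subst lborel_eq, subst integrable_distr_eq)
      (auto simp: eq int intro!: product_integrable_prod)
qed

text \<open>
  The Gaussian density and the exponential both factor over the coordinates, which reduces the
  Fourier transform to the one-dimensional standard normal law; frequency zero gives the total mass.
\<close>

lemma
  fixes x :: "'a::euclidean_space"
  shows integral_std_gaussian_cos: "(LINT z|std_gaussian. cos (z \<bullet> x)) = exp (- (norm x)\<^sup>2 / 2)"
    and prob_space_std_gaussian: "prob_space (std_gaussian :: 'a measure)"
proof -
  define F :: "'a \<Rightarrow> 'a \<Rightarrow> real \<Rightarrow> complex"
    where "F = (\<lambda>x b u. complex_of_real (std_normal_density u) * iexp (u * (x \<bullet> b)))"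
  have F_int: "integrable lborel (F x b)" for x b
    unfolding F_def
  proof (rule Bochner_Integration.integrable_bound[OF integrable_normal_density[of 1 0]])
    show "AE u in lborel. norm (complex_of_real (std_normal_density u) * iexp (u * (x \<bullet> b)))
        \<le> norm (std_normal_density u)"
      unfolding norm_mult norm_exp_i_times by simp
  qed auto
  have F: "(\<integral>u. F x b u \<partial>lborel) = of_real (exp (- (x \<bullet> b)\<^sup>2 / 2))" for x b
  proof -
    have "of_real (exp (- (x \<bullet> b)\<^sup>2 / 2)) = char std_normal_distribution (x \<bullet> b)"
      by (simp add: char_std_normal_distribution)
    also have "\<dots> = (\<integral>u. std_normal_density u *\<^sub>R iexp ((x \<bullet> b) * u) \<partial>lborel)"
      unfolding char_def by (rule integral_density) auto
    also have "\<dots> = (\<integral>u. F x b u \<partial>lborel)"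
      by (simp add: F_def scaleR_conv_of_real mult.commute)
    finally show ?thesis ..
  qed
  have prod_F: "(\<Prod>b\<in>Basis. F x b (z \<bullet> b)) = of_real (\<Prod>b\<in>Basis. std_normal_density (z \<bullet> b)) * iexp (z \<bullet> x)" for x z
    by (simp add: F_def prod.distrib euclidean_inner[of z x] sum_distrib_left exp_sum)
  have dens0: "(\<Prod>b\<in>Basis. std_normal_density (z \<bullet> b)) \<ge> 0" for z :: 'a
    by (intro prod_nonneg) auto
  have main: "(\<integral>z. (\<Prod>b\<in>Basis. std_normal_density (z \<bullet> b)) *\<^sub>R iexp (z \<bullet> x) \<partial>lborel)
      = of_real (exp (- (norm x)\<^sup>2 / 2))"
    and int: "integrable lborel (\<lambda>z. (\<Prod>b\<in>Basis. std_normal_density (z \<bullet> b)) *\<^sub>R iexp (z \<bullet> x))" for x :: 'a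
  proof -
    have "(\<integral>z. (\<Prod>b\<in>Basis. std_normal_density (z \<bullet> b)) *\<^sub>R iexp (z \<bullet> x) \<partial>lborel)
       = (\<Prod>b\<in>Basis. of_real (exp (- (x \<bullet> b)\<^sup>2 / 2)))"
      using lborel_integral_prod(1)[of "F x", OF F_int]
      by (simp add: prod_F F scaleR_conv_of_real del: of_real_prod)
    also have "\<dots> = of_real (exp (\<Sum>b\<in>Basis. - (x \<bullet> b)\<^sup>2 / 2))"
      by (simp add: exp_sum)
    also have "(\<Sum>b\<in>Basis. - (x \<bullet> b)\<^sup>2 / 2) = - (norm x)\<^sup>2 / 2"
      unfolding power2_norm_eq_inner euclidean_inner[of x x]
      by (simp add: sum_negf power2_eq_square flip: sum_divide_distrib)
    finally show "(\<integral>z. (\<Prod>b\<in>Basis. std_normal_density (z \<bullet> b)) *\<^sub>R iexp (z \<bullet> x) \<partial>lborel)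
      = of_real (exp (- (norm x)\<^sup>2 / 2))" .
    show "integrable lborel (\<lambda>z. (\<Prod>b\<in>Basis. std_normal_density (z \<bullet> b)) *\<^sub>R iexp (z \<bullet> x))"
      using lborel_integral_prod(2)[of "F x", OF F_int]
      by (simp add: prod_F scaleR_conv_of_real del: of_real_prod)
  qed
  have cos_eq: "(LINT z|std_gaussian. cos (z \<bullet> x)) = exp (- (norm x)\<^sup>2 / 2)" for x :: 'a
  proof -
    have "(LINT z|std_gaussian. cos (z \<bullet> x)) = (\<integral>z. (\<Prod>b\<in>Basis. std_normal_density (z \<bullet> b)) *\<^sub>R cos (z \<bullet> x) \<partial>lborel)"
      unfolding std_gaussian_eq_prod by (rule integral_density) (auto simp: dens0)
    also have "\<dots> = (\<integral>z. Re ((\<Prod>b\<in>Basis. std_normal_density (z \<bullet> b)) *\<^sub>R iexp (z \<bullet> x)) \<partial>lborel)"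
      by (simp add: Re_exp)
    also have "\<dots> = exp (- (norm x)\<^sup>2 / 2)"
      unfolding integral_Re[OF int] main by simp
    finally show ?thesis .
  qed
  show "(LINT z|std_gaussian. cos (z \<bullet> x)) = exp (- (norm x)\<^sup>2 / 2)" by (rule cos_eq)
  show "prob_space (std_gaussian :: 'a measure)"
  proof
    have "emeasure std_gaussian (space std_gaussian :: 'a set) = (\<integral>\<^sup>+z. ennreal (\<Prod>b\<in>Basis. std_normal_density (z \<bullet> b)) \<partial>(lborel :: 'a measure))"
      by (simp add: std_gaussian_eq_prod emeasure_density)
    also have "\<dots> = ennreal (\<integral>z. (\<Prod>b\<in>Basis. std_normal_density (z \<bullet> b)) \<partial>(lborel :: 'a measure))"
      using integrable_norm[OF int[of 0]] by (intro nn_integral_eq_integral) (auto simp: dens0)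
    also have "(\<integral>z. (\<Prod>b\<in>Basis. std_normal_density (z \<bullet> b)) \<partial>(lborel :: 'a measure)) = (LINT z|(std_gaussian::'a measure). cos (z \<bullet> 0))"
      unfolding std_gaussian_eq_prod by (subst integral_density) (auto simp: dens0)
    also have "\<dots> = 1" unfolding cos_eq by simp
    finally show "emeasure std_gaussian (space std_gaussian :: 'a set) = 1" by simp
  qed
qed

text \<open>
  The image of Lebesgue measure under half the squared norm plays the role of polar coordinates. In
  this variable a Gaussian is a plain exponential, so that radial moments become Gamma integrals.
\<close>

lemma distr_half_norm_square:
  "distr lborel borel (\<lambda>x::'a::euclidean_space. (norm x)\<^sup>2 / 2) =
     density lborel (\<lambda>t. ennreal (indicator {0..} t *
       (unit_ball_vol (real DIM('a)) * 2 powr (real DIM('a) / 2) * (real DIM('a) / 2) * t powr (real DIM('a) / 2 - 1))))"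
    (is "?L = ?R")
proof (rule measure_eqI_generator_eq[where E = "range (\<lambda>a::real. {..a})" and \<Omega> = UNIV and A = "\<lambda>n. {..real n}"])
  let ?d = "real DIM('a)"
  have emL: "emeasure ?L {..a} = (if a \<ge> 0 then ennreal (unit_ball_vol ?d * (2 * a) powr (?d / 2)) else 0)" for a
  proof -
    have "emeasure ?L {..a} = emeasure lborel {x::'a. (norm x)\<^sup>2 / 2 \<le> a}"
      by (subst emeasure_distr) (auto simp: vimage_def)
    also have "\<dots> = (if a \<ge> 0 then ennreal (unit_ball_vol ?d * (2 * a) powr (?d / 2)) else 0)"
    proof (cases "a \<ge> 0")
      case True
      have "{x::'a. (norm x)\<^sup>2 / 2 \<le> a} = cball 0 (sqrt (2 * a))"
      proof -
        have "(norm x)\<^sup>2 / 2 \<le> a \<longleftrightarrow> norm x \<le> sqrt (2 * a)" for x :: 'a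
        proof -
          have "(norm x)\<^sup>2 / 2 \<le> a \<longleftrightarrow> (norm x)\<^sup>2 \<le> 2 * a" by linarith
          also have "\<dots> \<longleftrightarrow> norm x \<le> sqrt (2 * a)"
            using real_sqrt_le_iff[of "(norm x)\<^sup>2" "2 * a"] by simp
          finally show ?thesis .
        qed
        then show ?thesis by (simp add: cball_def)
      qed
      moreover have "sqrt (2 * a) ^ DIM('a) = (2 * a) powr (?d / 2)"
      proof (cases "a = 0")
        case False
        then have "sqrt (2 * a) ^ DIM('a) = ((2 * a) powr (1/2)) powr ?d"
          using True by (simp add: powr_half_sqrt powr_realpow)
        then show ?thesis by (simp add: powr_powr)
      qed simp
      ultimately show ?thesis using True by (simp add: emeasure_cball)
    next
      case False
      have "\<not> (norm x)\<^sup>2 / 2 \<le> a" for x :: 'a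
        using False zero_le_power2[of "norm x"] by linarith
      then have "{x::'a. (norm x)\<^sup>2 / 2 \<le> a} = {}" by blast
      with False show ?thesis by simp
    qed
    finally show ?thesis .
  qed
  have emR: "emeasure ?R {..a} = (if a \<ge> 0 then ennreal (unit_ball_vol ?d * (2 * a) powr (?d / 2)) else 0)" for a
  proof (cases "a \<ge> 0")
    case True
    let ?c = "unit_ball_vol ?d * 2 powr (?d / 2) * (?d / 2)"
    have "((\<lambda>t. ?c * t powr (?d / 2 - 1)) has_integral ?c * (a powr (?d / 2 - 1 + 1) / (?d / 2 - 1 + 1))) {0..a}"
      using True by (intro has_integral_mult_right has_integral_powr_from_0) auto
    from nn_integral_has_integral_lebesgue[OF _ this]
    have "(\<integral>\<^sup>+t. ennreal (indicator {0..a} t * (?c * t powr (?d / 2 - 1))) \<partial>lborel)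
        = ennreal (?c * (a powr (?d / 2) / (?d / 2)))"
      by simp
    also have "?c * (a powr (?d / 2) / (?d / 2)) = unit_ball_vol ?d * (2 * a) powr (?d / 2)"
      using True by (simp add: powr_mult)
    finally have "(\<integral>\<^sup>+t. ennreal (indicator {0..a} t * (?c * t powr (?d / 2 - 1))) \<partial>lborel)
        = ennreal (unit_ball_vol ?d * (2 * a) powr (?d / 2))" .
    moreover have "emeasure ?R {..a} = (\<integral>\<^sup>+t. ennreal (indicator {0..a} t * (?c * t powr (?d / 2 - 1))) \<partial>lborel)"
      by (subst emeasure_density) (auto intro!: nn_integral_cong split: split_indicator)
    ultimately show ?thesis using True by simp
  next
    case False
    have "emeasure ?R {..a} = (\<integral>\<^sup>+t. 0 \<partial>(lborel::real measure))"
      by (subst emeasure_density, measurable, rule nn_integral_cong)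
        (use False in \<open>auto split: split_indicator\<close>)
    with False show ?thesis by simp
  qed
  show "emeasure ?L Y = emeasure ?R Y" if "Y \<in> range (\<lambda>a::real. {..a})" for Y
    using that emL emR by auto
  show "emeasure ?L {..real i} \<noteq> \<infinity>" for i by (simp add: emL)
  show "(\<Union>i. {..real i}) = UNIV" using real_arch_simple by auto
  show "Int_stable (range (\<lambda>a::real. {..a}))"
    by (auto simp: Int_stable_def)
qed (auto simp: borel_eq_atMost)

lemma nn_integral_Gamma_scaled:
  fixes s q :: real
  assumes "s > 0" "q > 0"
  shows "(\<integral>\<^sup>+t. ennreal (indicator {0..} t * (exp (- q * t) * t powr (s - 1))) \<partial>lborel) = ennreal (q powr (- s) * Gamma s)"
proof -
  have "ennreal (Gamma s) = (\<integral>\<^sup>+t. ennreal (indicator {0..} t * t powr (s - 1) / exp t) \<partial>lborel)"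
    using Gamma_conv_nn_integral_real[OF assms(1)] .
  also have "\<dots> = ennreal \<bar>q\<bar> * (\<integral>\<^sup>+t. ennreal (indicator {0..} (0 + q * t) * (0 + q * t) powr (s - 1) / exp (0 + q * t)) \<partial>lborel)"
    using assms(2) by (intro nn_integral_real_affine) auto
  also have "\<dots> = (\<integral>\<^sup>+t. ennreal (q powr s) * ennreal (indicator {0..} t * (exp (- q * t) * t powr (s - 1))) \<partial>lborel)"
    using assms
    by (subst nn_integral_cmult[symmetric])
      (auto intro!: nn_integral_cong split: split_indicator
        simp: zero_le_mult_iff powr_mult exp_minus field_simps powr_diff simp flip: ennreal_mult)
  also have "\<dots> = ennreal (q powr s) * (\<integral>\<^sup>+t. ennreal (indicator {0..} t * (exp (- q * t) * t powr (s - 1))) \<partial>lborel)"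
    by (rule nn_integral_cmult) measurable
  finally have *: "ennreal (Gamma s) = ennreal (q powr s) * (\<integral>\<^sup>+t. ennreal (indicator {0..} t * (exp (- q * t) * t powr (s - 1))) \<partial>lborel)" (is "_ = _ * ?I") .
  have "ennreal (q powr (- s) * Gamma s) = ennreal (q powr (- s)) * (ennreal (q powr s) * ?I)"
    unfolding *[symmetric] by (rule ennreal_mult') simp
  also have "\<dots> = ennreal (q powr (- s) * q powr s) * ?I"
    by (simp add: ennreal_mult mult.assoc)
  also have "q powr (- s) * q powr s = 1"
    using assms by (simp flip: powr_add)
  finally show ?thesis by simp
qed

lemma nn_integral_radial_gaussian_moment:
  fixes b q :: real
  assumes "b > 0" "q > 0"
  shows "(\<integral>\<^sup>+x. ennreal (exp (- q * ((norm x)\<^sup>2 / 2)) * norm x powr (b - real DIM('a))) \<partial>(lborel :: 'a::euclidean_space measure))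
    = ennreal (unit_ball_vol (real DIM('a)) * (real DIM('a) / 2) * (2 / q) powr (b / 2) * Gamma (b / 2))"
proof -
  let ?d = "real DIM('a)"
  let ?V = "unit_ball_vol ?d"
  let ?h = "\<lambda>t::real. exp (- q * t) * (2 * t) powr ((b - ?d) / 2)"
  let ?c = "?V * (?d / 2) * 2 powr (b / 2)"
  have "(\<integral>\<^sup>+x. ennreal (exp (- q * ((norm x)\<^sup>2 / 2)) * norm x powr (b - ?d)) \<partial>(lborel :: 'a measure))
     = (\<integral>\<^sup>+x. ennreal (?h ((norm x)\<^sup>2 / 2)) \<partial>(lborel :: 'a measure))"
  proof (rule nn_integral_cong)
    fix x :: 'a
    have "(2 * ((norm x)\<^sup>2 / 2)) powr ((b - ?d) / 2) = norm x powr (b - ?d)"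
    proof (cases "x = 0")
      case False
      then have "(2 * ((norm x)\<^sup>2 / 2)) powr ((b - ?d) / 2) = (norm x powr 2) powr ((b - ?d) / 2)"
        by simp
      also have "\<dots> = norm x powr (2 * ((b - ?d) / 2))" by (rule powr_powr)
      also have "2 * ((b - ?d) / 2) = b - ?d" by simp
      finally show ?thesis .
    qed simp
    then show "ennreal (exp (- q * ((norm x)\<^sup>2 / 2)) * norm x powr (b - ?d)) = ennreal (?h ((norm x)\<^sup>2 / 2))"
      by simp
  qed
  also have "\<dots> = (\<integral>\<^sup>+t. ennreal (?h t) \<partial>distr lborel borel (\<lambda>x::'a. (norm x)\<^sup>2 / 2))"
    by (subst nn_integral_distr) auto
  also have "\<dots> = (\<integral>\<^sup>+t. ennreal ?c * ennreal (indicator {0..} t * (exp (- q * t) * t powr (b / 2 - 1))) \<partial>lborel)"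
    unfolding distr_half_norm_square
  proof (subst nn_integral_density, measurable, rule nn_integral_cong)
    fix t :: real
    show "ennreal (indicator {0..} t * (?V * 2 powr (?d / 2) * (?d / 2) * t powr (?d / 2 - 1))) * ennreal (?h t)
        = ennreal ?c * ennreal (indicator {0..} t * (exp (- q * t) * t powr (b / 2 - 1)))"
    proof (cases "t > 0")
      case True
      have "2 powr (?d / 2) * t powr (?d / 2 - 1) * (2 * t) powr ((b - ?d) / 2)
          = (2 powr (?d / 2) * 2 powr ((b - ?d) / 2)) * (t powr (?d / 2 - 1) * t powr ((b - ?d) / 2))"
        using True by (simp add: powr_mult)
      also have "\<dots> = 2 powr (b / 2) * t powr (b / 2 - 1)"
        by (simp add: diff_divide_distrib flip: powr_add)
      finally show ?thesis
        using True by (simp add: mult.assoc mult.left_commute flip: ennreal_mult)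
    qed (auto split: split_indicator)
  qed
  also have "\<dots> = ennreal ?c * ennreal (q powr (- (b / 2)) * Gamma (b / 2))"
    using nn_integral_Gamma_scaled[of "b / 2" q] assms by (subst nn_integral_cmult) auto
  also have "\<dots> = ennreal (?V * (?d / 2) * (2 / q) powr (b / 2) * Gamma (b / 2))"
    using assms by (subst ennreal_mult'[symmetric]) (auto simp: powr_divide powr_minus_divide field_simps)
  finally show ?thesis .
qed

section \<open>The potential measure\<close>

lemma levy_process_integral_continuous:
  fixes X :: "real \<Rightarrow> 'w \<Rightarrow> 'a::euclidean_space" and f :: "'a \<Rightarrow> real"
  assumes levy: "levy_process M X"
    and lip: "\<And>x y. \<bar>f x - f y\<bar> \<le> L * dist x y" and bd: "\<And>x. \<bar>f x\<bar> \<le> 1"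
    and [measurable]: "f \<in> borel_measurable borel"
  shows "continuous_on {0..} (\<lambda>t. LINT \<omega>|M. f (X t \<omega>))"
proof -
  interpret prob_space M using levy by (simp add: levy_process_def)
  have X[measurable]: "X t \<in> borel_measurable M" if "t \<ge> 0" for t
    using levy that by (simp add: levy_process_def)
  have "L \<ge> 0"
  proof -
    obtain b :: 'a where "b \<in> Basis" using nonempty_Basis by blast
    then have "b \<noteq> 0" by auto
    have "0 \<le> L * dist b 0" using lip[of b 0] by linarith
    then show ?thesis using \<open>b \<noteq> 0\<close> by (simp add: zero_le_mult_iff)
  qed
  have int: "integrable M (\<lambda>\<omega>. f (X t \<omega>))" if "t \<ge> 0" for t
    using that bd by (intro integrable_const_bound[where B = 1]) auto
  have diff: "\<bar>(LINT \<omega>|M. f (X t \<omega>)) - (LINT \<omega>|M. f (X s \<omega>))\<bar>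
      \<le> L * e + 2 * prob {\<omega> \<in> space M. e < dist (X t \<omega>) (X s \<omega>)}"
    if st: "s \<ge> 0" "t \<ge> 0" "e > 0" for s t e
  proof -
    note [measurable] = X[OF st(1)] X[OF st(2)]
    let ?B = "{\<omega> \<in> space M. e < dist (X t \<omega>) (X s \<omega>)}"
    have "?B \<in> sets M" by measurable
    then have B: "integrable M (indicator ?B :: 'w \<Rightarrow> real)" "(LINT \<omega>|M. indicator ?B \<omega>) = prob ?B"
      by (auto simp: less_top[symmetric] intro!: integrable_real_indicator)
    have "\<bar>(LINT \<omega>|M. f (X t \<omega>)) - (LINT \<omega>|M. f (X s \<omega>))\<bar> = \<bar>LINT \<omega>|M. f (X t \<omega>) - f (X s \<omega>)\<bar>"
      using int st by simp
    also have "\<dots> \<le> (LINT \<omega>|M. L * e + 2 * indicator ?B \<omega>)"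
    proof (rule order_trans[OF integral_abs_bound], rule integral_mono)
      fix \<omega> assume \<omega>: "\<omega> \<in> space M"
      show "\<bar>f (X t \<omega>) - f (X s \<omega>)\<bar> \<le> L * e + 2 * indicator ?B \<omega>"
      proof (cases "\<omega> \<in> ?B")
        case True
        moreover have "0 \<le> L * e" using \<open>L \<ge> 0\<close> st(3) by simp
        moreover have "\<bar>f (X t \<omega>) - f (X s \<omega>)\<bar> \<le> 2"
          using bd[of "X t \<omega>"] bd[of "X s \<omega>"] by linarith
        ultimately show ?thesis by simp
      next
        case False
        then have "L * dist (X t \<omega>) (X s \<omega>) \<le> L * e"
          using \<omega> \<open>L \<ge> 0\<close> by (intro mult_left_mono) auto
        then show ?thesis using lip[of "X t \<omega>" "X s \<omega>"] False by simp
      qed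
    qed (use int st B in auto)
    also have "\<dots> = L * e + 2 * prob ?B"
      using B by (simp add: prob_space del: Bochner_Integration.integral_indicator)
    finally show ?thesis .
  qed
  show ?thesis
    unfolding continuous_on_def
  proof (intro ballI tendstoI)
    fix s \<epsilon> :: real assume s: "s \<in> {0..}" and "\<epsilon> > 0"
    define e where "e = \<epsilon> / (2 * (L + 1))"
    have "e > 0" using \<open>\<epsilon> > 0\<close> \<open>L \<ge> 0\<close> by (simp add: e_def)
    have "L * e \<le> \<epsilon> / 2"
      using \<open>\<epsilon> > 0\<close> \<open>L \<ge> 0\<close> by (simp add: e_def field_simps)
    have "((\<lambda>t. prob {\<omega> \<in> space M. e < dist (X t \<omega>) (X s \<omega>)}) \<longlongrightarrow> 0) (at s within {0..})"
      using levy s \<open>e > 0\<close> by (simp add: levy_process_def)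
    then have "\<forall>\<^sub>F t in at s within {0..}. prob {\<omega> \<in> space M. e < dist (X t \<omega>) (X s \<omega>)} < \<epsilon> / 4"
      using \<open>\<epsilon> > 0\<close> by (intro order_tendstoD) auto
    moreover have "\<forall>\<^sub>F t in at s within {0..}. t \<ge> 0"
      by (simp add: eventually_at_filter)
    ultimately show "\<forall>\<^sub>F t in at s within {0..}. dist (LINT \<omega>|M. f (X t \<omega>)) (LINT \<omega>|M. f (X s \<omega>)) < \<epsilon>"
    proof eventually_elim
      case (elim t)
      then show ?case
        using diff[of s t e] s \<open>e > 0\<close> \<open>L * e \<le> \<epsilon> / 2\<close> by (simp add: dist_real_def)
    qed
  qed
qed

text \<open>
  Expectations of bounded Lipschitz functions are continuous in time by stochastic continuity.
  Indicators of closed sets are limits of such functions, and closed sets generate the Borel sets.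
  Without this measurability the set function defining the potential measure need not be additive.
\<close>

lemma levy_process_law_measurable:
  fixes X :: "real \<Rightarrow> 'w \<Rightarrow> 'a::euclidean_space"
  assumes levy: "levy_process M X"
  shows "(\<lambda>t. distr M borel (X (max 0 t))) \<in> borel \<rightarrow>\<^sub>M subprob_algebra borel"
proof (rule measurable_subprob_algebra_generated[where \<Omega> = UNIV and G = "Collect closed"])
  interpret prob_space M using levy by (simp add: levy_process_def)
  have X[measurable]: "X (max 0 t) \<in> borel_measurable M" for t
    using levy by (simp add: levy_process_def)
  have ps: "prob_space (distr M borel (X (max 0 t)))" for t
    by (rule prob_space_distr) measurable
  then show "subprob_space (distr M borel (X (max 0 t)))" for t
    by (rule prob_space_imp_subprob_space)
  have "emeasure (distr M borel (X (max 0 t))) UNIV = 1" for t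
    using prob_space.emeasure_space_1[OF ps[of t]] by simp
  then show "(\<lambda>t. emeasure (distr M borel (X (max 0 t))) UNIV) \<in> borel_measurable borel" by simp
  fix A :: "'a set" assume "A \<in> Collect closed"
  then have "closed A" by simp
  show "(\<lambda>t. emeasure (distr M borel (X (max 0 t))) A) \<in> borel_measurable borel"
  proof (cases "A = {}")
    case False
    have [measurable]: "A \<in> sets borel" using \<open>closed A\<close> by simp
    \<comment> \<open>Lipschitz functions that decrease to the indicator of \<open>A\<close>\<close>
    define f where "f n x = max 0 (1 - real n * infdist x A)" for n x
    have f_cont: "continuous_on UNIV (f n)" for n
      unfolding f_def by (intro continuous_intros)
    have [measurable]: "f n \<in> borel_measurable borel" for n
      by (intro borel_measurable_continuous_onI f_cont)
    have f_bd: "\<bar>f n x\<bar> \<le> 1" for n x by (auto simp: f_def infdist_nonneg)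
    have f_lip: "\<bar>f n x - f n y\<bar> \<le> real n * dist x y" for n x y
    proof -
      have "\<bar>infdist x A - infdist y A\<bar> \<le> dist x y"
        using infdist_triangle_abs[of x A y] by simp
      then have "real n * \<bar>infdist x A - infdist y A\<bar> \<le> real n * dist x y"
        by (intro mult_left_mono) auto
      then have "\<bar>real n * infdist x A - real n * infdist y A\<bar> \<le> real n * dist x y"
        by (simp add: abs_mult flip: right_diff_distrib)
      then show ?thesis unfolding f_def by linarith
    qed
    have f_meas: "(\<lambda>t. LINT \<omega>|M. f n (X (max 0 t) \<omega>)) \<in> borel_measurable borel" for n
    proof (rule borel_measurable_continuous_onI)
      have "continuous_on UNIV ((\<lambda>t. LINT \<omega>|M. f n (X t \<omega>)) \<circ> (\<lambda>t::real. max 0 t))"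
        by (intro continuous_on_compose continuous_intros
            continuous_on_subset[OF levy_process_integral_continuous[OF levy f_lip f_bd]]) auto
      then show "continuous_on UNIV (\<lambda>t. LINT \<omega>|M. f n (X (max 0 t) \<omega>))"
        by (simp add: o_def)
    qed
    have f_lim: "(\<lambda>n. f n x) \<longlonglongrightarrow> indicator A x" for x
    proof (cases "x \<in> A")
      case True
      then show ?thesis by (simp add: f_def)
    next
      case False
      with \<open>A \<noteq> {}\<close> \<open>closed A\<close> have "infdist x A > 0"
        by (simp add: infdist_pos_not_in_closed)
      then obtain n0 :: nat where n0: "1 < real n0 * infdist x A"
        using reals_Archimedean3 by blast
      have "\<forall>\<^sub>F n in sequentially. f n x = 0"
        using eventually_ge_at_top[of n0]
      proof eventually_elim
        case (elim n)
        then have "real n0 * infdist x A \<le> real n * infdist x A"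
          by (intro mult_right_mono infdist_nonneg) auto
        with n0 show ?case by (simp add: f_def)
      qed
      then show ?thesis using False by (simp add: tendsto_eventually)
    qed
    have lim: "(\<lambda>n. LINT \<omega>|M. f n (X (max 0 t) \<omega>)) \<longlonglongrightarrow> measure (distr M borel (X (max 0 t))) A" for t
    proof -
      have "(\<lambda>n. LINT \<omega>|M. f n (X (max 0 t) \<omega>)) \<longlonglongrightarrow> (LINT \<omega>|M. indicator A (X (max 0 t) \<omega>))"
        by (rule integral_dominated_convergence[where w = "\<lambda>_. 1"]) (auto simp: f_lim f_bd)
      also have "(LINT \<omega>|M. indicator A (X (max 0 t) \<omega>)) = (LINT x|distr M borel (X (max 0 t)). indicator A x :: real)"
        by (rule integral_distr[symmetric]) auto
      also have "\<dots> = measure (distr M borel (X (max 0 t))) A"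
        by simp
      finally show ?thesis .
    qed
    have "(\<lambda>t. measure (distr M borel (X (max 0 t))) A) \<in> borel_measurable borel"
      by (rule borel_measurable_LIMSEQ_metric[OF f_meas lim])
    then have "(\<lambda>t. ennreal (measure (distr M borel (X (max 0 t))) A)) \<in> borel_measurable borel"
      by measurable
    also have "(\<lambda>t. ennreal (measure (distr M borel (X (max 0 t))) A)) = (\<lambda>t. emeasure (distr M borel (X (max 0 t))) A)"
      using finite_measure.emeasure_eq_measure[OF prob_space.finite_measure[OF ps]] by metis
    finally show ?thesis .
  qed simp
qed (auto simp: borel_eq_closed Int_stable_def)

lemma sets_potential_measure [simp]: "sets (potential_measure M X) = sets borel"
  by (simp add: potential_measure_def sets.sigma_sets_eq[of borel, simplified])

lemma nn_integral_potential_measure: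
  fixes X :: "real \<Rightarrow> 'w \<Rightarrow> 'a::euclidean_space"
  assumes levy: "levy_process M X" and f: "f \<in> borel_measurable borel"
  shows "(\<integral>\<^sup>+x. f x \<partial>potential_measure M X)
    = (\<integral>\<^sup>+t\<in>{0..}. (\<integral>\<^sup>+x. f x \<partial>distr M borel (X t)) \<partial>lborel)"
proof -
  let ?T = "restrict_space lborel {0::real..}"
  let ?K = "\<lambda>t. distr M borel (X (max 0 t))"
  have K: "?K \<in> ?T \<rightarrow>\<^sub>M subprob_algebra borel"
    using levy_process_law_measurable[OF levy] by (intro measurable_restrict_space1) simp
  have T: "space ?T \<noteq> {}" by (simp add: space_restrict_space)
  have sets_N: "sets (?T \<bind> ?K) = sets borel"
    by (rule sets_bind[OF _ T]) simp
  have em: "emeasure (?T \<bind> ?K) A = (\<integral>\<^sup>+t\<in>{0..}. emeasure M {\<omega> \<in> space M. X t \<omega> \<in> A} \<partial>lborel)"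
    if "A \<in> sets borel" for A
  proof -
    have "emeasure (?T \<bind> ?K) A = (\<integral>\<^sup>+t. emeasure (?K t) A \<partial>?T)"
      by (rule emeasure_bind[OF T K that])
    also have "\<dots> = (\<integral>\<^sup>+t\<in>{0..}. emeasure (?K t) A \<partial>lborel)"
      by (rule nn_integral_restrict_space) simp
    also have "\<dots> = (\<integral>\<^sup>+t\<in>{0..}. emeasure M {\<omega> \<in> space M. X t \<omega> \<in> A} \<partial>lborel)"
    proof (rule nn_integral_cong)
      fix t :: real
      have "X t \<in> borel_measurable M" if "t \<ge> 0"
        using levy that by (simp add: levy_process_def)
      then show "emeasure (?K t) A * indicator {0..} t = emeasure M {\<omega> \<in> space M. X t \<omega> \<in> A} * indicator {0..} t"
        using that by (auto simp: emeasure_distr vimage_def Int_def conj_commute split: split_indicator)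
    qed
    finally show ?thesis .
  qed
  have eq: "potential_measure M X = ?T \<bind> ?K"
  proof -
    have "potential_measure M X = measure_of UNIV (sets borel) (emeasure (?T \<bind> ?K))"
      unfolding potential_measure_def
      by (rule measure_of_eq) (auto simp: em sets.sigma_sets_eq[of borel, simplified])
    also have "\<dots> = ?T \<bind> ?K"
      using measure_of_of_measure[of "?T \<bind> ?K"] sets_N sets_eq_imp_space_eq[OF sets_N] by simp
    finally show ?thesis .
  qed
  have "(\<integral>\<^sup>+x. f x \<partial>potential_measure M X) = (\<integral>\<^sup>+t. (\<integral>\<^sup>+x. f x \<partial>?K t) \<partial>?T)"
    unfolding eq by (rule nn_integral_bind[OF f K])
  also have "\<dots> = (\<integral>\<^sup>+t\<in>{0..}. (\<integral>\<^sup>+x. f x \<partial>?K t) \<partial>lborel)"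
    by (rule nn_integral_restrict_space) simp
  also have "\<dots> = (\<integral>\<^sup>+t\<in>{0..}. (\<integral>\<^sup>+x. f x \<partial>distr M borel (X t)) \<partial>lborel)"
    by (rule nn_integral_cong) (auto split: split_indicator)
  finally show ?thesis .
qed

text \<open>
  Every law at a positive time is absolutely continuous off the origin, hence so is the potential
  measure, and its singular part can only be an atom at the origin.
\<close>

lemma potential_measure_ac_off_0:
  fixes X :: "real \<Rightarrow> 'w \<Rightarrow> 'a::euclidean_space"
  assumes proc: "isotropic_unimodal_levy_process M X" and G: "ac_part_density (potential_measure M X) G"
    and A: "A \<in> sets borel" "0 \<notin> A"
  shows "emeasure (potential_measure M X) A = (\<integral>\<^sup>+x\<in>A. ennreal (G x) \<partial>lborel)"
proof -
  let ?N = "potential_measure M X"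
  note levy = isotropic_unimodal_levy_processD(1)[OF proc]
  obtain N\<^sub>s S where S: "S \<in> null_sets lborel" and Ns: "sets N\<^sub>s = sets borel" "emeasure N\<^sub>s (- S) = 0"
    and N: "\<And>A. A \<in> sets borel \<Longrightarrow> emeasure ?N A = (\<integral>\<^sup>+x\<in>A. ennreal (G x) \<partial>lborel) + emeasure N\<^sub>s A"
    using G unfolding ac_part_density_def by blast
  have [measurable]: "S \<in> sets borel" "A \<in> sets borel" using S A by auto
  have "emeasure ?N (A \<inter> S) = (\<integral>\<^sup>+x. indicator (A \<inter> S) x \<partial>?N)"
    by (rule nn_integral_indicator[symmetric]) simp
  also have "\<dots> = (\<integral>\<^sup>+t\<in>{0..}. (\<integral>\<^sup>+x. indicator (A \<inter> S) x \<partial>distr M borel (X t)) \<partial>lborel)"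
    by (rule nn_integral_potential_measure[OF levy]) measurable
  also have "\<dots> = (\<integral>\<^sup>+t. 0 \<partial>(lborel :: real measure))"
  proof (rule nn_integral_cong_AE, use AE_lborel_singleton[of "0::real"] in eventually_elim)
    fix t :: real assume "t \<noteq> 0"
    have "emeasure (distr M borel (X t)) (A \<inter> S) = 0" if t0: "t > 0"
    proof -
      obtain g where g: "\<And>A. A \<in> sets borel \<Longrightarrow> 0 \<notin> A \<Longrightarrow>
          emeasure (distr M borel (X t)) A = (\<integral>\<^sup>+x\<in>A. ennreal (g x) \<partial>lborel)"
        using isotropic_unimodal_levy_processD(4)[OF proc t0]
        unfolding isotropic_unimodal_measure_def by blast
      have "emeasure (distr M borel (X t)) (A \<inter> S) = (\<integral>\<^sup>+x\<in>A \<inter> S. ennreal (g x) \<partial>lborel)"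
        by (rule g) (use A in auto)
      also have "\<dots> = 0"
        by (rule nn_integral_null_set) (use S A in \<open>auto intro: null_set_Int1\<close>)
      finally show ?thesis .
    qed
    with \<open>t \<noteq> 0\<close> show "(\<integral>\<^sup>+x. indicator (A \<inter> S) x \<partial>distr M borel (X t)) * indicator {0..} t = 0"
      by (auto split: split_indicator)
  qed
  finally have "emeasure ?N (A \<inter> S) = 0" by simp
  then have "emeasure N\<^sub>s (A \<inter> S) = 0"
    using N[of "A \<inter> S"] by simp
  moreover have "emeasure N\<^sub>s (A - S) = 0"
    using emeasure_mono[of "A - S" "- S" N\<^sub>s] Ns by auto
  moreover have "emeasure N\<^sub>s A \<le> emeasure N\<^sub>s (A \<inter> S) + emeasure N\<^sub>s (A - S)"
    using emeasure_subadditive[of "A \<inter> S" N\<^sub>s "A - S"] by (simp add: Ns(1) Int_Diff_Un)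
  ultimately have "emeasure N\<^sub>s A = 0" by simp
  then show ?thesis using N[OF A(1)] by simp
qed

text \<open>
  This is Parseval's identity for \<open>p\<^sub>t\<close> and a Gaussian.
\<close>

lemma nn_integral_gaussian_law:
  fixes X :: "real \<Rightarrow> 'w \<Rightarrow> 'a::euclidean_space"
  assumes "isotropic_unimodal_levy_process M X" "levy_khintchine_exponent M X \<psi>" "t \<ge> 0"
  shows "(\<integral>\<^sup>+x. ennreal (exp (- (norm (l *\<^sub>R x))\<^sup>2 / 2)) \<partial>distr M borel (X t))
    = (\<integral>\<^sup>+z. ennreal (exp (- t * \<psi> (l *\<^sub>R z))) \<partial>std_gaussian)"
proof -
  let ?p = "distr M borel (X t)" and ?ga = "std_gaussian :: 'a measure"
  note \<psi>0 = levy_exponent_nonneg[OF assms(1,2)]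
  note [measurable] = levy_exponent_measurable[OF assms(1,2)]
  interpret p: prob_space ?p
    by (rule isotropic_unimodal_levy_processD(2)[OF assms(1,3)])
  interpret ga: prob_space ?ga by (rule prob_space_std_gaussian)
  interpret pair: pair_prob_space ?p ?ga ..
  have int: "integrable (?p \<Otimes>\<^sub>M ?ga) (\<lambda>(x, z). cos (z \<bullet> (l *\<^sub>R x)))"
    by (rule pair.integrable_const_bound[where B = 1]) auto
  have "(\<integral>\<^sup>+x. ennreal (exp (- (norm (l *\<^sub>R x))\<^sup>2 / 2)) \<partial>?p) = ennreal (LINT x|?p. exp (- (norm (l *\<^sub>R x))\<^sup>2 / 2))"
    by (intro nn_integral_eq_integral p.integrable_const_bound[where B = 1]) auto
  also have "(LINT x|?p. exp (- (norm (l *\<^sub>R x))\<^sup>2 / 2)) = (LINT x|?p. LINT z|?ga. cos (z \<bullet> (l *\<^sub>R x)))"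
    by (simp only: integral_std_gaussian_cos)
  also have "\<dots> = (LINT z|?ga. LINT x|?p. cos (z \<bullet> (l *\<^sub>R x)))"
    by (rule pair.Fubini_integral[OF int, symmetric])
  also have "\<dots> = (LINT z|?ga. exp (- t * \<psi> (l *\<^sub>R z)))"
  proof (rule Bochner_Integration.integral_cong[OF refl])
    fix z show "(LINT x|?p. cos (z \<bullet> (l *\<^sub>R x))) = exp (- t * \<psi> (l *\<^sub>R z))"
      using integral_cos_eq_exp[OF assms, of "l *\<^sub>R z"] by simp
  qed
  also have "ennreal \<dots> = (\<integral>\<^sup>+z. ennreal (exp (- t * \<psi> (l *\<^sub>R z))) \<partial>?ga)"
    using \<psi>0 assms(3)
    by (intro nn_integral_eq_integral[symmetric] ga.integrable_const_bound[where B = 1]) auto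
  finally show ?thesis .
qed

text \<open>
  Integrating \<open>exp (- t * \<psi>)\<close> over \<open>t \<ge> 0\<close> gives \<open>1/\<psi>\<close>, so the reciprocal of the exponent acts as the
  Fourier transform of the potential measure. Everything is nonnegative, so the identity holds whether
  or not the integrals are finite.
\<close>

lemma nn_integral_gaussian_potential:
  fixes X :: "real \<Rightarrow> 'w \<Rightarrow> 'a::euclidean_space"
  assumes "isotropic_unimodal_levy_process M X" "levy_khintchine_exponent M X \<psi>"
    and pos: "\<And>\<xi>. \<xi> \<noteq> 0 \<Longrightarrow> 0 < \<psi> \<xi>" and "l \<noteq> 0"
  shows "(\<integral>\<^sup>+x. ennreal (exp (- (norm (l *\<^sub>R x))\<^sup>2 / 2)) \<partial>potential_measure M X)
    = (\<integral>\<^sup>+z. ennreal (1 / \<psi> (l *\<^sub>R z)) \<partial>std_gaussian)"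
proof -
  let ?ga = "std_gaussian :: 'a measure"
  note [measurable] = levy_exponent_measurable[OF assms(1,2)]
  interpret ga: prob_space ?ga by (rule prob_space_std_gaussian)
  interpret pair: pair_sigma_finite "lborel :: real measure" ?ga ..
  have "(\<integral>\<^sup>+x. ennreal (exp (- (norm (l *\<^sub>R x))\<^sup>2 / 2)) \<partial>potential_measure M X)
     = (\<integral>\<^sup>+t\<in>{0..}. (\<integral>\<^sup>+x. ennreal (exp (- (norm (l *\<^sub>R x))\<^sup>2 / 2)) \<partial>distr M borel (X t)) \<partial>lborel)"
    by (rule nn_integral_potential_measure[OF isotropic_unimodal_levy_processD(1)[OF assms(1)]]) measurable
  also have "\<dots> = (\<integral>\<^sup>+t. \<integral>\<^sup>+z. indicator {0..} t * ennreal (exp (- t * \<psi> (l *\<^sub>R z))) \<partial>?ga \<partial>lborel)"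
  proof (rule nn_integral_cong)
    fix t :: real
    show "(\<integral>\<^sup>+x. ennreal (exp (- (norm (l *\<^sub>R x))\<^sup>2 / 2)) \<partial>distr M borel (X t)) * indicator {0..} t
        = (\<integral>\<^sup>+z. indicator {0..} t * ennreal (exp (- t * \<psi> (l *\<^sub>R z))) \<partial>?ga)"
    proof (cases "t \<ge> 0")
      case True
      show ?thesis
        unfolding nn_integral_gaussian_law[OF assms(1,2) True] using True by simp
    qed simp
  qed
  also have "\<dots> = (\<integral>\<^sup>+z. \<integral>\<^sup>+t. indicator {0..} t * ennreal (exp (- t * \<psi> (l *\<^sub>R z))) \<partial>lborel \<partial>?ga)"
    by (rule pair.Fubini'[symmetric]) measurable
  also have "\<dots> = (\<integral>\<^sup>+z. ennreal (1 / \<psi> (l *\<^sub>R z)) \<partial>?ga)"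
  proof (rule nn_integral_cong_AE)
    have "AE z in ?ga. z \<noteq> 0"
      unfolding std_gaussian_def using AE_lborel_singleton[of "0::'a"] by (simp add: AE_density)
    then show "AE z in ?ga. (\<integral>\<^sup>+t. indicator {0..} t * ennreal (exp (- t * \<psi> (l *\<^sub>R z))) \<partial>lborel) = ennreal (1 / \<psi> (l *\<^sub>R z))"
    proof eventually_elim
      fix z :: 'a assume "z \<noteq> 0"
      then have "\<psi> (l *\<^sub>R z) > 0" using pos \<open>l \<noteq> 0\<close> by simp
      from has_integral_exp_minus_to_infinity[OF this, of 0]
      have "((\<lambda>t. exp (- t * \<psi> (l *\<^sub>R z))) has_integral 1 / \<psi> (l *\<^sub>R z)) {0..}"
        by (simp add: mult.commute)
      from nn_integral_has_integral_lebesgue[OF _ this]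
      show "(\<integral>\<^sup>+t. indicator {0..} t * ennreal (exp (- t * \<psi> (l *\<^sub>R z))) \<partial>lborel) = ennreal (1 / \<psi> (l *\<^sub>R z))"
        by (simp add: ennreal_mult ennreal_indicator)
    qed
  qed
  finally show ?thesis .
qed

section \<open>Convergence of moments\<close>

lemma nn_integral_std_gaussian_powr:
  fixes b :: real
  assumes "b < real DIM('a::euclidean_space)"
  shows "(\<integral>\<^sup>+z. ennreal (norm z powr (- b)) \<partial>(std_gaussian :: 'a measure))
    = ennreal ((2 * pi) powr (- real DIM('a) / 2) * (unit_ball_vol (real DIM('a)) * (real DIM('a) / 2)
        * 2 powr ((real DIM('a) - b) / 2) * Gamma ((real DIM('a) - b) / 2)))"
proof -
  let ?d = "real DIM('a)"
  have "(\<integral>\<^sup>+z. ennreal (norm z powr (- b)) \<partial>(std_gaussian :: 'a measure))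
     = (\<integral>\<^sup>+z. ennreal ((2 * pi) powr (- ?d / 2)) *
          ennreal (exp (- 1 * ((norm z)\<^sup>2 / 2)) * norm z powr ((?d - b) - ?d)) \<partial>(lborel :: 'a measure))"
    unfolding std_gaussian_def
    by (subst nn_integral_density)
      (auto intro!: nn_integral_cong simp: mult.assoc simp flip: ennreal_mult)
  also have "\<dots> = ennreal ((2 * pi) powr (- ?d / 2)) *
      (\<integral>\<^sup>+z. ennreal (exp (- 1 * ((norm z)\<^sup>2 / 2)) * norm z powr ((?d - b) - ?d)) \<partial>(lborel :: 'a measure))"
    by (rule nn_integral_cmult) measurable
  also have "\<dots> = ennreal ((2 * pi) powr (- ?d / 2)) *
      ennreal (unit_ball_vol ?d * (?d / 2) * (2 / 1) powr ((?d - b) / 2) * Gamma ((?d - b) / 2))"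
    using assms by (subst nn_integral_radial_gaussian_moment) auto
  finally show ?thesis by (simp flip: ennreal_mult')
qed

lemma nn_integral_lborel_scaleR:
  fixes f :: "'a::euclidean_space \<Rightarrow> ennreal"
  assumes [measurable]: "f \<in> borel_measurable borel" and "r > 0"
  shows "(\<integral>\<^sup>+x. f x \<partial>lborel) = (\<integral>\<^sup>+y. ennreal (r ^ DIM('a)) * f (r *\<^sub>R y) \<partial>lborel)"
proof -
  have "(\<integral>\<^sup>+x. f x \<partial>lborel) = (\<integral>\<^sup>+x. f x \<partial>density (distr lborel borel (\<lambda>x. 0 + r *\<^sub>R x)) (\<lambda>_. \<bar>r\<bar> ^ DIM('a)))"
    using \<open>r > 0\<close> by (subst lborel_affine[of r 0]) auto
  also have "\<dots> = (\<integral>\<^sup>+y. ennreal (r ^ DIM('a)) * f (r *\<^sub>R y) \<partial>lborel)"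
    using \<open>r > 0\<close> by (simp add: nn_integral_density nn_integral_distr)
  finally show ?thesis .
qed

text \<open>
  Regular variation makes \<open>\<psi>\<close> positive near the origin only; almost monotonicity along rays carries
  positivity outwards.
\<close>

lemma levy_exponent_pos:
  fixes X :: "real \<Rightarrow> 'w \<Rightarrow> 'a::euclidean_space"
  assumes proc: "isotropic_unimodal_levy_process M X" and lk: "levy_khintchine_exponent M X \<psi>"
    and rv: "regularly_varying_at_zero \<alpha> (radial_profile \<psi>)" and "\<xi> \<noteq> 0"
  shows "0 < \<psi> \<xi>"
proof -
  obtain x0 where x0: "x0 > 0" "0 < inverse (radial_profile \<psi> (inverse x0))"
    using rv unfolding regularly_varying_at_zero_def regularly_varying_at_infinity_def by auto
  define c where "c = inverse x0 / norm \<xi>"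
  have "norm (c *\<^sub>R \<xi>) = inverse x0" using x0(1) \<open>\<xi> \<noteq> 0\<close> by (simp add: c_def)
  then have "0 < \<psi> (c *\<^sub>R \<xi>)"
    using x0(2) radial_profile_norm[of \<psi> "c *\<^sub>R \<xi>", OF levy_exponent_radial[OF proc lk]] by simp
  also have "\<dots> \<le> 18 * max 1 (c\<^sup>2) * \<psi> \<xi>"
    by (rule levy_exponent_growth[OF proc lk])
  finally show ?thesis
    using levy_exponent_nonneg[OF proc lk, of \<xi>] by (auto simp: less_le)
qed

text \<open>
  The growth bound is applied with the factor \<open>1 / (l * norm z)\<close>, which takes \<open>(l/r) z\<close> to a vector of
  length \<open>1/r\<close>. It bounds the ratio by \<open>18 * (1 + norm z powr (- 2))\<close>, whose Gaussian integral is finite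
  in dimension at least three.
\<close>

lemma levy_exponent_ratio_limit:
  fixes X :: "real \<Rightarrow> 'w \<Rightarrow> 'a::euclidean_space"
  assumes proc: "isotropic_unimodal_levy_process M X" and lk: "levy_khintchine_exponent M X \<psi>"
    and rv: "regularly_varying_at_zero \<alpha> (radial_profile \<psi>)"
    and dim: "DIM('a) \<ge> 3" and "l \<ge> 1"
  shows "((\<lambda>r. LINT z|std_gaussian. radial_profile \<psi> (inverse r) / \<psi> ((l / r) *\<^sub>R z)) \<longlongrightarrow>
           (LINT z|(std_gaussian :: 'a measure). (l * norm z) powr (- \<alpha>))) at_top"
    and "r > 0 \<Longrightarrow> integrable std_gaussian (\<lambda>z. radial_profile \<psi> (inverse r) / \<psi> ((l / r) *\<^sub>R z))"
proof -
  let ?ga = "std_gaussian :: 'a measure" and ?\<Psi> = "radial_profile \<psi>"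
  note \<psi>_radial = levy_exponent_radial[OF proc lk]
  note [measurable] = levy_exponent_measurable[OF proc lk]
  note pos = levy_exponent_pos[OF proc lk rv]
  interpret ga: prob_space ?ga by (rule prob_space_std_gaussian)
  have \<Psi>: "?\<Psi> (norm \<xi>) = \<psi> \<xi>" for \<xi> by (rule radial_profile_norm[OF \<psi>_radial])
  have \<psi>_scale: "\<psi> ((l / r) *\<^sub>R z) = ?\<Psi> (inverse (inverse (l * norm z) * r))" if "r > 0" for r z
    using that \<open>l \<ge> 1\<close> by (subst \<Psi>[symmetric]) (simp add: divide_inverse ac_simps)
  define w :: "'a \<Rightarrow> real" where "w z = 18 * (1 + norm z powr (- 2))" for z
  have "integrable ?ga (\<lambda>z. norm z powr (- 2))"
  proof (rule integrableI_bounded)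
    have "(\<integral>\<^sup>+z. ennreal (norm (norm z powr (- 2))) \<partial>?ga) = (\<integral>\<^sup>+z. ennreal (norm z powr (- 2)) \<partial>?ga)"
      by simp
    also have "\<dots> < \<infinity>"
      using dim by (subst nn_integral_std_gaussian_powr) auto
    finally show "(\<integral>\<^sup>+z. ennreal (norm (norm z powr (- 2))) \<partial>?ga) < \<infinity>" .
  qed measurable
  then have w_int: "integrable ?ga w" unfolding w_def by simp
  have bound: "norm (?\<Psi> (inverse r) / \<psi> ((l / r) *\<^sub>R z)) \<le> w z" if "r > 0" for r z
  proof (cases "z = 0")
    case True
    have "\<psi> 0 = 0"
    proof -
      interpret p: prob_space "distr M borel (X 1)"
        by (rule isotropic_unimodal_levy_processD(2)[OF proc]) simp
      show ?thesis using integral_cos_eq_exp[OF proc lk, of 1 0] p.prob_space by simp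
    qed
    with True show ?thesis by (simp add: w_def)
  next
    case False
    define v where "v = (l / r) *\<^sub>R z"
    have "v \<noteq> 0" using False that \<open>l \<ge> 1\<close> by (simp add: v_def)
    have small: "(1 / (l * norm z))\<^sup>2 \<le> norm z powr (- 2)"
    proof -
      have "norm z \<le> l * norm z" using \<open>l \<ge> 1\<close> by (simp add: mult_le_cancel_right1)
      then have "1 / (l * norm z) \<le> 1 / norm z"
        using False by (intro divide_left_mono) auto
      then have "(1 / (l * norm z))\<^sup>2 \<le> (1 / norm z)\<^sup>2"
        using \<open>l \<ge> 1\<close> by (intro power_mono) auto
      also have "\<dots> = norm z powr (- 2)"
        using False by (simp add: powr_minus_divide power_divide)
      finally show ?thesis .
    qed
    have "norm ((1 / (l * norm z)) *\<^sub>R v) = inverse r"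
      using False that \<open>l \<ge> 1\<close> by (simp add: v_def inverse_eq_divide)
    then have "?\<Psi> (inverse r) = \<psi> ((1 / (l * norm z)) *\<^sub>R v)"
      using \<Psi> by metis
    also have "\<dots> \<le> 18 * max 1 ((1 / (l * norm z))\<^sup>2) * \<psi> v"
      by (rule levy_exponent_growth[OF proc lk])
    finally have "?\<Psi> (inverse r) / \<psi> v \<le> 18 * max 1 ((1 / (l * norm z))\<^sup>2)"
      using pos[OF \<open>v \<noteq> 0\<close>] by (simp add: divide_le_eq)
    also have "\<dots> \<le> 18 * (1 + norm z powr (- 2))"
      using small powr_ge_zero[of "norm z" "- 2"] by (intro mult_left_mono max.boundedI) linarith+
    finally have "?\<Psi> (inverse r) / \<psi> v \<le> w z" by (simp add: w_def)
    moreover have "0 \<le> ?\<Psi> (inverse r) / \<psi> v"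
      using \<open>?\<Psi> (inverse r) = \<psi> ((1 / (l * norm z)) *\<^sub>R v)\<close> levy_exponent_nonneg[OF proc lk] by simp
    ultimately show ?thesis by (simp add: v_def)
  qed
  show "integrable ?ga (\<lambda>z. ?\<Psi> (inverse r) / \<psi> ((l / r) *\<^sub>R z))" if "r > 0"
    by (rule Bochner_Integration.integrable_bound[OF w_int])
      (use bound[OF that] in \<open>auto intro: order_trans[OF _ abs_ge_self]\<close>)
  show "((\<lambda>r. LINT z|?ga. ?\<Psi> (inverse r) / \<psi> ((l / r) *\<^sub>R z)) \<longlongrightarrow> (LINT z|?ga. (l * norm z) powr (- \<alpha>))) at_top"
  proof (rule integral_dominated_convergence_at_top[where w = w])
    show "AE z in ?ga. ((\<lambda>r. ?\<Psi> (inverse r) / \<psi> ((l / r) *\<^sub>R z)) \<longlongrightarrow> (l * norm z) powr (- \<alpha>)) at_top"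
    proof -
      have "AE z in ?ga. z \<noteq> 0"
        unfolding std_gaussian_def using AE_lborel_singleton[of "0::'a"] by (simp add: AE_density)
      then show ?thesis
      proof eventually_elim
        fix z :: 'a assume "z \<noteq> 0"
        define c where "c = inverse (l * norm z)"
        have "c > 0" using \<open>z \<noteq> 0\<close> \<open>l \<ge> 1\<close> by (simp add: c_def)
        then have "((\<lambda>r. inverse (?\<Psi> (inverse (c * r))) / inverse (?\<Psi> (inverse r))) \<longlongrightarrow> c powr \<alpha>) at_top"
          using rv unfolding regularly_varying_at_zero_def regularly_varying_at_infinity_def by blast
        moreover have "\<forall>\<^sub>F r in at_top. inverse (?\<Psi> (inverse (c * r))) / inverse (?\<Psi> (inverse r))
            = ?\<Psi> (inverse r) / \<psi> ((l / r) *\<^sub>R z)"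
          using eventually_gt_at_top[of 0]
        proof eventually_elim
          fix r :: real assume "0 < r"
          have "inverse a / inverse b = b / a" for a b :: real by (simp add: divide_inverse mult.commute)
          then show "inverse (?\<Psi> (inverse (c * r))) / inverse (?\<Psi> (inverse r))
              = ?\<Psi> (inverse r) / \<psi> ((l / r) *\<^sub>R z)"
            unfolding \<psi>_scale[OF \<open>0 < r\<close>] c_def by blast
        qed
        ultimately have "((\<lambda>r. ?\<Psi> (inverse r) / \<psi> ((l / r) *\<^sub>R z)) \<longlongrightarrow> c powr \<alpha>) at_top"
          by (rule Lim_transform_eventually)
        also have "c powr \<alpha> = (l * norm z) powr (- \<alpha>)"
          using \<open>z \<noteq> 0\<close> \<open>l \<ge> 1\<close> unfolding c_def by (intro inverse_powr[THEN trans]) (auto simp: powr_minus)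
        finally show "((\<lambda>r. ?\<Psi> (inverse r) / \<psi> ((l / r) *\<^sub>R z)) \<longlongrightarrow> (l * norm z) powr (- \<alpha>)) at_top" .
      qed
    qed
    show "\<forall>\<^sub>F r in at_top. AE z in ?ga. norm (?\<Psi> (inverse r) / \<psi> ((l / r) *\<^sub>R z)) \<le> w z"
      using eventually_gt_at_top[of 0] by eventually_elim (intro AE_I2 bound)
  qed (use w_int in measurable)
qed

text \<open>
  Measures on \<open>[0,1]\<close> are determined by their moments, and quantitatively so by Weierstrass
  approximation; the moment of order zero keeps the total masses bounded.
\<close>

lemma moment_convergence_imp_weak_convergence:
  fixes m :: "'b \<Rightarrow> real measure" and m0 :: "real measure" and f :: "real \<Rightarrow> real"
  assumes fin: "\<forall>\<^sub>F r in F. finite_measure (m r)" "finite_measure m0"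
    and sets: "\<And>r. sets (m r) = sets borel" "sets m0 = sets borel"
    and supp: "\<And>r. AE u in m r. u \<in> {0..1}" "AE u in m0. u \<in> {0..1}"
    and mom: "\<And>k. ((\<lambda>r. LINT u|m r. u ^ k) \<longlongrightarrow> (LINT u|m0. u ^ k)) F"
    and f: "continuous_on UNIV f"
  shows "((\<lambda>r. LINT u|m r. f u) \<longlongrightarrow> (LINT u|m0. f u)) F"
proof (rule tendstoI)
  fix \<epsilon> :: real assume "\<epsilon> > 0"
  have f_meas: "f \<in> borel_measurable borel" by (rule borel_measurable_continuous_onI[OF f])
  define B where "B = measure m0 UNIV + 1"
  have "B > 0" by (simp add: B_def add_nonneg_pos)
  define \<delta> where "\<delta> = \<epsilon> / (4 * B)"
  have "\<delta> > 0" using \<open>\<epsilon> > 0\<close> \<open>B > 0\<close> by (simp add: \<delta>_def)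
  obtain g where g: "real_polynomial_function g" "\<And>x. x \<in> {0..1} \<Longrightarrow> \<bar>f x - g x\<bar> < \<delta>"
    using Stone_Weierstrass_real_polynomial_function[of "{0..1}" f \<delta>] \<open>\<delta> > 0\<close> continuous_on_subset[OF f]
    by (metis compact_Icc subset_UNIV)
  obtain a n where g_eq: "g = (\<lambda>x. \<Sum>i\<le>n. a i * x ^ i)"
    using g(1) unfolding real_polynomial_function_iff_sum by blast
  have g_cont: "continuous_on UNIV g" unfolding g_eq by (intro continuous_intros)
  have integrable: "integrable M h"
    if M: "finite_measure M" "sets M = sets borel" "AE u in M. u \<in> {0..1}" "continuous_on UNIV h"
    for M :: "real measure" and h :: "real \<Rightarrow> real"
  proof -
    interpret finite_measure M by fact
    obtain C where C: "\<And>u. u \<in> {0..1} \<Longrightarrow> norm (h u) \<le> C"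
      using compact_imp_bounded[OF compact_continuous_image[OF continuous_on_subset[OF M(4)] compact_Icc, of 0 1]]
      unfolding bounded_iff by blast
    have "h \<in> borel_measurable M"
      using borel_measurable_continuous_onI[OF M(4)] measurable_cong_sets[OF M(2) refl] by blast
    then show ?thesis
      by (intro integrable_const_bound[where B = C] eventually_mono[OF M(3) C])
  qed
  have approx: "\<bar>(LINT u|M. f u) - (LINT u|M. g u)\<bar> \<le> \<delta> * measure M UNIV"
    if M: "finite_measure M" "sets M = sets borel" "AE u in M. u \<in> {0..1}" for M :: "real measure"
  proof -
    interpret finite_measure M by fact
    have sp: "space M = UNIV" using sets_eq_imp_space_eq[OF M(2)] by simp
    note int = integrable[OF M f] integrable[OF M g_cont]
    have "\<bar>(LINT u|M. f u) - (LINT u|M. g u)\<bar> = \<bar>LINT u|M. f u - g u\<bar>"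
      using int by simp
    also have "\<dots> \<le> (LINT u|M. \<bar>f u - g u\<bar>)" by (rule integral_abs_bound)
    also have "\<dots> \<le> (LINT u|M. \<delta>)"
      using int eventually_mono[OF M(3) less_imp_le[OF g(2)]] by (intro integral_mono_AE) auto
    also have "\<dots> = \<delta> * measure M UNIV" using sp by simp
    finally show ?thesis .
  qed
  have poly: "(LINT u|M. g u) = (\<Sum>i\<le>n. a i * (LINT u|M. u ^ i))"
    if M: "finite_measure M" "sets M = sets borel" "AE u in M. u \<in> {0..1}" for M :: "real measure"
    unfolding g_eq
    by (subst Bochner_Integration.integral_sum) (auto intro!: integrable[OF M] continuous_intros)
  have mass: "(LINT u|M. u ^ 0) = measure M UNIV" if "sets M = sets borel" for M :: "real measure"
    using sets_eq_imp_space_eq[OF that] by simp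
  have "((\<lambda>r. \<Sum>i\<le>n. a i * (LINT u|m r. u ^ i)) \<longlongrightarrow> (\<Sum>i\<le>n. a i * (LINT u|m0. u ^ i))) F"
    by (intro tendsto_intros mom)
  then have "\<forall>\<^sub>F r in F. dist (\<Sum>i\<le>n. a i * (LINT u|m r. u ^ i)) (\<Sum>i\<le>n. a i * (LINT u|m0. u ^ i)) < \<epsilon> / 2"
    using \<open>\<epsilon> > 0\<close> by (intro tendstoD) auto
  moreover have "\<forall>\<^sub>F r in F. measure (m r) UNIV < B"
    using order_tendstoD(2)[OF mom[of 0], of B] by (simp only: mass sets B_def)
  ultimately show "\<forall>\<^sub>F r in F. dist (LINT u|m r. f u) (LINT u|m0. f u) < \<epsilon>"
    using fin(1)
  proof eventually_elim
    case (elim r)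
    have "\<delta> * measure (m r) UNIV < \<epsilon> / 4"
      using elim(2) \<open>\<delta> > 0\<close> \<open>B > 0\<close> mult_strict_left_mono[OF elim(2) \<open>\<delta> > 0\<close>] by (simp add: \<delta>_def)
    moreover have "\<delta> * measure m0 UNIV < \<epsilon> / 4"
    proof -
      have "measure m0 UNIV < B" by (simp add: B_def)
      from mult_strict_left_mono[OF this \<open>\<delta> > 0\<close>] show ?thesis using \<open>B > 0\<close> by (simp add: \<delta>_def)
    qed
    moreover have "\<bar>(LINT u|m r. g u) - (LINT u|m0. g u)\<bar> < \<epsilon> / 2"
      using elim(1) unfolding poly[OF elim(3) sets(1) supp(1)] poly[OF fin(2) sets(2) supp(2)] dist_real_def .
    ultimately show ?case
      using approx[OF elim(3) sets(1) supp(1)] approx[OF fin(2) sets(2) supp(2)]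
      unfolding dist_real_def by linarith
  qed
qed

section \<open>Vague convergence of the rescaled potential\<close>

definition gauss :: "'a::real_normed_vector \<Rightarrow> real" where
  "gauss x = exp (- (norm x)\<^sup>2 / 2)"

lemma gauss_bounds: "0 < gauss x" "gauss x \<le> 1" "gauss x \<in> {0..1}"
  by (auto simp: gauss_def)

lemma gauss_0 [simp]: "gauss 0 = 1"
  by (simp add: gauss_def)

lemma gauss_measurable [measurable]: "gauss \<in> borel_measurable borel"
  unfolding gauss_def by measurable

lemma gauss_power: "gauss x ^ n = exp (- (norm (sqrt (real n) *\<^sub>R x))\<^sup>2 / 2)"
  by (simp add: gauss_def power_mult_distrib flip: exp_of_nat_mult)

text \<open>
  The normalization for which \<open>riesz_constant d \<alpha> * norm x powr (\<alpha> - d)\<close> has Fourier transform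
  \<open>norm \<xi> powr (- \<alpha>)\<close>.
\<close>

definition riesz_constant :: "real \<Rightarrow> real \<Rightarrow> real" where
  "riesz_constant d \<alpha> = 2 powr (- \<alpha>) * pi powr (- d / 2) * (Gamma ((d - \<alpha>) / 2) / Gamma (\<alpha> / 2))"

lemma riesz_constant_pos: "0 < \<alpha> \<Longrightarrow> \<alpha> < d \<Longrightarrow> 0 < riesz_constant d \<alpha>"
  by (simp add: riesz_constant_def Gamma_real_pos)

text \<open>
  Both sides evaluate the pairing of the Riesz kernel with the Gaussian \<open>exp (- q * |x|\<^sup>2 / 2)\<close>: the left
  one directly, the right one on the Fourier side.
\<close>

lemma riesz_constant_identity:
  assumes "0 < \<alpha>" "\<alpha> < d" "0 < q"
  shows "riesz_constant d \<alpha> * (unit_ball_vol d * (d / 2) * (2 / q) powr (\<alpha> / 2) * Gamma (\<alpha> / 2)) =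
    sqrt q powr (- \<alpha>) * ((2 * pi) powr (- d / 2) *
      (unit_ball_vol d * (d / 2) * 2 powr ((d - \<alpha>) / 2) * Gamma ((d - \<alpha>) / 2)))"
proof -
  have "Gamma (\<alpha> / 2) > 0" using assms by (intro Gamma_real_pos) simp
  then have "Gamma (\<alpha> / 2) \<noteq> 0" by simp
  moreover have "(2 / q) powr (\<alpha> / 2) = 2 powr (\<alpha> / 2) * sqrt q powr (- \<alpha>)"
    using assms by (simp add: powr_divide powr_powr powr_minus_divide flip: powr_half_sqrt)
  moreover have "2 powr (- \<alpha>) * 2 powr (\<alpha> / 2) = 2 powr (- d / 2) * (2 powr ((d - \<alpha>) / 2) :: real)"
    by (simp add: diff_divide_distrib flip: powr_add)
  moreover have "(2 * pi) powr (- d / 2) = 2 powr (- d / 2) * pi powr (- d / 2)"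
    by (simp add: powr_mult)
  ultimately show ?thesis
    unfolding riesz_constant_def by (simp add: mult.assoc mult.left_commute)
qed

text \<open>
  Both integrals are turned into integrals of \<open>f\<close> against finite measures on \<open>[0,1]\<close>, by pushing
  forward under \<open>u = gauss (x /\<^sub>R r)\<close> the rescaled potential measure weighted by \<open>u\<close>. The weight
  \<open>u\<close> makes these measures finite, and turns the moment of order \<open>k\<close> into a Gaussian integral of
  parameter \<open>k + 1\<close>.
\<close>

lemma scaled_potential_vague_limit:
  fixes X :: "real \<Rightarrow> 'w \<Rightarrow> 'a::euclidean_space" and f :: "real \<Rightarrow> real"
  assumes dim: "DIM('a) \<ge> 3" and proc: "isotropic_unimodal_levy_process M X"
    and lk: "levy_khintchine_exponent M X \<psi>"
    and \<alpha>: "0 < \<alpha>" "\<alpha> \<le> 2" and rv: "regularly_varying_at_zero \<alpha> (radial_profile \<psi>)"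
    and f: "continuous_on UNIV f"
  shows "((\<lambda>r. LINT x|potential_measure M X.
            radial_profile \<psi> (inverse r) * gauss (x /\<^sub>R r) * f (gauss (x /\<^sub>R r))) \<longlongrightarrow>
         (LINT y|(lborel :: 'a measure).
            riesz_constant (real DIM('a)) \<alpha> * norm y powr (\<alpha> - real DIM('a)) * gauss y * f (gauss y))) at_top"
    (is "(?\<Phi> \<longlongrightarrow> ?L) at_top")
    and "r > 0 \<Longrightarrow> integrable (potential_measure M X)
           (\<lambda>x. radial_profile \<psi> (inverse r) * gauss (x /\<^sub>R r) * f (gauss (x /\<^sub>R r)))"
    and "integrable lborel (\<lambda>y::'a. 
           riesz_constant (real DIM('a)) \<alpha> * norm y powr (\<alpha> - real DIM('a)) * gauss y * f (gauss y))"
proof -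
  let ?N = "potential_measure M X" and ?\<Psi> = "radial_profile \<psi>" and ?ga = "std_gaussian :: 'a measure"
  let ?d = "real DIM('a)"
  let ?K = "riesz_constant ?d \<alpha>"
  note [measurable_cong] = sets_potential_measure[of M X]
  note [measurable] = levy_exponent_measurable[OF proc lk]
  have K: "?K > 0" using \<alpha> dim by (intro riesz_constant_pos) auto
  have \<Psi>0: "?\<Psi> (inverse r) \<ge> 0" if "r > 0" for r
  proof -
    obtain b :: 'a where "b \<in> Basis" using nonempty_Basis by blast
    then have "norm (inverse r *\<^sub>R b) = inverse r" using that by simp
    then show ?thesis
      using radial_profile_norm[of \<psi> "inverse r *\<^sub>R b", OF levy_exponent_radial[OF proc lk]]
        levy_exponent_nonneg[OF proc lk] by metis
  qed
  define m where "m r = distr (density ?N (\<lambda>x. ennreal (?\<Psi> (inverse r) * gauss (x /\<^sub>R r)))) borel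
      (\<lambda>x. gauss (x /\<^sub>R r))" for r
  define m0 where "m0 = distr (density lborel (\<lambda>y::'a. ennreal (?K * norm y powr (\<alpha> - ?d) * gauss y))) borel gauss"
  have sets: "sets (m r) = sets borel" "sets m0 = sets borel" for r
    by (simp_all add: m_def m0_def)
  have space: "space (m r) = UNIV" "space m0 = UNIV" for r
    by (simp_all add: m_def m0_def)
  have supp: "AE u in m r. u \<in> {0..1}" "AE u in m0. u \<in> {0..1}" for r
  proof -
    have AE: "AE u in distr \<mu> borel h. u \<in> {0..1}"
      if h: "h \<in> borel_measurable \<mu>" "\<And>x. h x \<in> {0..1}" for \<mu> :: "'a measure" and h :: "'a \<Rightarrow> real"
    proof (subst AE_distr_iff[OF h(1)])
      show "{u \<in> space borel. u \<in> {0..1::real}} \<in> sets borel" by simp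
      show "AE x in \<mu>. h x \<in> {0..1}" by (rule AE_I2) (rule h(2))
    qed
    show "AE u in m r. u \<in> {0..1}" unfolding m_def
      by (rule AE[OF _ gauss_bounds(3)]) measurable
    show "AE u in m0. u \<in> {0..1}" unfolding m0_def
    proof (rule AE)
      show "gauss \<in> borel_measurable (density lborel (\<lambda>y::'a. ennreal (?K * norm y powr (\<alpha> - ?d) * gauss y)))"
        by simp
    qed (rule gauss_bounds(3))
  qed
  have mom_r: "(\<integral>\<^sup>+u. ennreal (u ^ k) \<partial>m r) =
      ennreal (LINT z|?ga. ?\<Psi> (inverse r) / \<psi> ((sqrt (real (Suc k)) / r) *\<^sub>R z))" if r: "r > 0" for k r
  proof -
    let ?l = "sqrt (real (Suc k)) / r"
    have gk: "gauss (x /\<^sub>R r) ^ k * gauss (x /\<^sub>R r) = exp (- (norm (?l *\<^sub>R x))\<^sup>2 / 2)" for x :: 'a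
    proof -
      have "?l *\<^sub>R x = sqrt (real (Suc k)) *\<^sub>R (x /\<^sub>R r)" by (simp add: divide_inverse)
      then show ?thesis unfolding power_Suc2[symmetric] unfolding gauss_power by (simp only:)
    qed
    have "(\<integral>\<^sup>+u. ennreal (u ^ k) \<partial>m r) =
        (\<integral>\<^sup>+x. ennreal (?\<Psi> (inverse r) * gauss (x /\<^sub>R r)) * ennreal (gauss (x /\<^sub>R r) ^ k) \<partial>?N)"
      unfolding m_def by (simp add: nn_integral_distr nn_integral_density)
    also have "\<dots> = (\<integral>\<^sup>+x. ennreal (?\<Psi> (inverse r)) * ennreal (exp (- (norm (?l *\<^sub>R x))\<^sup>2 / 2)) \<partial>?N)"
    proof (rule nn_integral_cong)
      fix x :: 'a
      have "0 \<le> gauss (x /\<^sub>R r)" by (simp add: gauss_bounds less_imp_le)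
      then show "ennreal (?\<Psi> (inverse r) * gauss (x /\<^sub>R r)) * ennreal (gauss (x /\<^sub>R r) ^ k)
          = ennreal (?\<Psi> (inverse r)) * ennreal (exp (- (norm (?l *\<^sub>R x))\<^sup>2 / 2))"
        unfolding gk[symmetric] using \<Psi>0[OF r] by (simp add: ennreal_mult ac_simps)
    qed
    also have "\<dots> = ennreal (?\<Psi> (inverse r)) * (\<integral>\<^sup>+x. ennreal (exp (- (norm (?l *\<^sub>R x))\<^sup>2 / 2)) \<partial>?N)"
      by (rule nn_integral_cmult) measurable
    also have "\<dots> = ennreal (?\<Psi> (inverse r)) * (\<integral>\<^sup>+z. ennreal (1 / \<psi> (?l *\<^sub>R z)) \<partial>?ga)"
      using r by (subst nn_integral_gaussian_potential[OF proc lk levy_exponent_pos[OF proc lk rv]]) auto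
    also have "\<dots> = (\<integral>\<^sup>+z. ennreal (?\<Psi> (inverse r) / \<psi> (?l *\<^sub>R z)) \<partial>?ga)"
      by (subst nn_integral_cmult[symmetric], measurable, rule nn_integral_cong)
        (simp add: \<Psi>0[OF r] levy_exponent_nonneg[OF proc lk] flip: ennreal_mult)
    also have "\<dots> = ennreal (LINT z|?ga. ?\<Psi> (inverse r) / \<psi> (?l *\<^sub>R z))"
      by (intro nn_integral_eq_integral levy_exponent_ratio_limit(2)[OF proc lk rv dim _ r])
        (auto simp: \<Psi>0[OF r] levy_exponent_nonneg[OF proc lk])
    finally show ?thesis .
  qed
  have mom_0: "(\<integral>\<^sup>+u. ennreal (u ^ k) \<partial>m0) =
      ennreal (LINT z|?ga. (sqrt (real (Suc k)) * norm z) powr (- \<alpha>))" for k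
  proof -
    let ?q = "real (Suc k)"
    have gk: "gauss y ^ k * gauss y = exp (- ?q * ((norm y)\<^sup>2 / 2))" for y :: 'a
    proof -
      have "exp (- ?q * ((norm y)\<^sup>2 / 2)) = exp (- (norm (sqrt ?q *\<^sub>R y))\<^sup>2 / 2)"
        by (simp add: power_mult_distrib algebra_simps)
      then show ?thesis unfolding power_Suc2[symmetric] unfolding gauss_power by (simp only:)
    qed
    have "(\<integral>\<^sup>+u. ennreal (u ^ k) \<partial>m0) =
        (\<integral>\<^sup>+y. ennreal (?K * norm y powr (\<alpha> - ?d) * gauss y) * ennreal (gauss y ^ k) \<partial>(lborel :: 'a measure))"
      unfolding m0_def by (simp add: nn_integral_distr nn_integral_density)
    also have "\<dots> = (\<integral>\<^sup>+y. ennreal ?K * ennreal (exp (- ?q * ((norm y)\<^sup>2 / 2)) * norm y powr (\<alpha> - ?d)) \<partial>(lborel :: 'a measure))"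
    proof (rule nn_integral_cong)
      fix y :: 'a
      have "0 \<le> gauss y" by (simp add: gauss_bounds less_imp_le)
      then show "ennreal (?K * norm y powr (\<alpha> - ?d) * gauss y) * ennreal (gauss y ^ k)
          = ennreal ?K * ennreal (exp (- ?q * ((norm y)\<^sup>2 / 2)) * norm y powr (\<alpha> - ?d))"
        unfolding gk[symmetric] using K by (simp add: ennreal_mult ac_simps)
    qed
    also have "\<dots> = ennreal ?K * (\<integral>\<^sup>+y. ennreal (exp (- ?q * ((norm y)\<^sup>2 / 2)) * norm y powr (\<alpha> - ?d)) \<partial>(lborel :: 'a measure))"
      by (rule nn_integral_cmult) measurable
    also have "\<dots> = ennreal ?K * ennreal (unit_ball_vol ?d * (?d / 2) * (2 / ?q) powr (\<alpha> / 2) * Gamma (\<alpha> / 2))"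
      using \<alpha> by (subst nn_integral_radial_gaussian_moment) simp_all
    also have "\<dots> = ennreal (?K * (unit_ball_vol ?d * (?d / 2) * (2 / ?q) powr (\<alpha> / 2) * Gamma (\<alpha> / 2)))"
      by (rule ennreal_mult'[symmetric]) (use K in simp)
    also have "?K * (unit_ball_vol ?d * (?d / 2) * (2 / ?q) powr (\<alpha> / 2) * Gamma (\<alpha> / 2)) =
        sqrt ?q powr (- \<alpha>) * ((2 * pi) powr (- ?d / 2) *
          (unit_ball_vol ?d * (?d / 2) * 2 powr ((?d - \<alpha>) / 2) * Gamma ((?d - \<alpha>) / 2)))"
      using \<alpha> dim by (intro riesz_constant_identity) auto
    also have "ennreal \<dots> = ennreal (sqrt ?q powr (- \<alpha>)) * (\<integral>\<^sup>+z. ennreal (norm z powr (- \<alpha>)) \<partial>?ga)"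
    proof (subst nn_integral_std_gaussian_powr)
      show "\<alpha> < ?d" using \<alpha> dim by simp
    qed (rule ennreal_mult', simp)
    also have "\<dots> = (\<integral>\<^sup>+z. ennreal ((sqrt ?q * norm z) powr (- \<alpha>)) \<partial>?ga)"
      by (subst nn_integral_cmult[symmetric]) (auto simp: powr_mult ennreal_mult')
    finally have eq: "(\<integral>\<^sup>+u. ennreal (u ^ k) \<partial>m0) = (\<integral>\<^sup>+z. ennreal ((sqrt ?q * norm z) powr (- \<alpha>)) \<partial>?ga)" .
    have "integrable ?ga (\<lambda>z. (sqrt ?q * norm z) powr (- \<alpha>))"
    proof (rule integrableI_nonneg)
      have "(\<integral>\<^sup>+z. ennreal ((sqrt ?q * norm z) powr (- \<alpha>)) \<partial>?ga) = ennreal (sqrt ?q powr (- \<alpha>)) * (\<integral>\<^sup>+z. ennreal (norm z powr (- \<alpha>)) \<partial>?ga)"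
        by (subst nn_integral_cmult[symmetric]) (auto simp: powr_mult ennreal_mult')
      also have "\<dots> < \<infinity>"
        using \<alpha> dim by (subst nn_integral_std_gaussian_powr) (auto simp: ennreal_mult_less_top)
      finally show "(\<integral>\<^sup>+z. ennreal ((sqrt ?q * norm z) powr (- \<alpha>)) \<partial>?ga) < \<infinity>" .
    qed auto
    then show ?thesis unfolding eq by (intro nn_integral_eq_integral) auto
  qed
  have fin_r: "finite_measure (m r)" if "r > 0" for r
    using mom_r[OF that, of 0] by (intro finite_measureI) (simp add: space)
  have fin_0: "finite_measure m0"
    using mom_0[of 0] by (intro finite_measureI) (simp add: space)
  have LINT_power: "(LINT u|\<mu>. u ^ k) = enn2real (\<integral>\<^sup>+u. ennreal (u ^ k) \<partial>\<mu>)"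
    if \<mu>: "sets \<mu> = sets borel" "AE u in \<mu>. u \<in> {0..1}" for \<mu> :: "real measure" and k
  proof (rule integral_eq_nn_integral)
    show "(\<lambda>u. u ^ k) \<in> borel_measurable \<mu>" using \<mu>(1) by (simp add: measurable_cong_sets[OF \<mu>(1) refl])
    show "AE u in \<mu>. 0 \<le> u ^ k" using \<mu>(2) by eventually_elim simp
  qed
  have weak: "((\<lambda>r. LINT u|m r. f u) \<longlongrightarrow> (LINT u|m0. f u)) at_top"
  proof (rule moment_convergence_imp_weak_convergence[OF _ fin_0 sets supp _ f])
    show "\<forall>\<^sub>F r in at_top. finite_measure (m r)"
      using eventually_gt_at_top[of 0] by eventually_elim (rule fin_r)
    fix k
    let ?l = "sqrt (real (Suc k))"
    have "((\<lambda>r. LINT z|?ga. ?\<Psi> (inverse r) / \<psi> ((?l / r) *\<^sub>R z)) \<longlongrightarrow>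
        (LINT z|?ga. (?l * norm z) powr (- \<alpha>))) at_top"
      by (rule levy_exponent_ratio_limit(1)[OF proc lk rv dim]) simp
    moreover have "(LINT u|m0. u ^ k) = (LINT z|?ga. (?l * norm z) powr (- \<alpha>))"
      unfolding LINT_power[OF sets(2) supp(2)] mom_0 by (rule enn2real_ennreal) (auto intro!: integral_nonneg_AE)
    moreover have "\<forall>\<^sub>F r in at_top. (LINT z|?ga. ?\<Psi> (inverse r) / \<psi> ((?l / r) *\<^sub>R z)) = (LINT u|m r. u ^ k)"
      using eventually_gt_at_top[of 0]
    proof eventually_elim
      fix r :: real assume r: "0 < r"
      show "(LINT z|?ga. ?\<Psi> (inverse r) / \<psi> ((?l / r) *\<^sub>R z)) = (LINT u|m r. u ^ k)"
        unfolding LINT_power[OF sets(1) supp(1)] mom_r[OF r]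
        by (rule enn2real_ennreal[symmetric])
          (auto intro!: integral_nonneg_AE simp: \<Psi>0[OF r] levy_exponent_nonneg[OF proc lk])
    qed
    ultimately show "((\<lambda>r. LINT u|m r. u ^ k) \<longlongrightarrow> (LINT u|m0. u ^ k)) at_top"
      by (simp add: Lim_transform_eventually)
  qed
  have [measurable]: "f \<in> borel_measurable borel" by (rule borel_measurable_continuous_onI[OF f])
  obtain C where C: "\<And>u. u \<in> {0..1} \<Longrightarrow> norm (f u) \<le> C"
    using compact_imp_bounded[OF compact_continuous_image[OF continuous_on_subset[OF f] compact_Icc, of 0 1]]
    unfolding bounded_iff by blast
  have int_f: "integrable \<mu> f"
    if \<mu>: "sets \<mu> = sets borel" "AE u in \<mu>. u \<in> {0..1}" "finite_measure \<mu>" for \<mu>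
    by (rule finite_measure.integrable_const_bound[OF \<mu>(3) eventually_mono[OF \<mu>(2) C]])
      (simp_all add: measurable_cong_sets[OF \<mu>(1) refl])
  have LINT_r: "(LINT u|m r. f u) = ?\<Phi> r" if r: "r > 0" for r
    unfolding m_def
    by (subst integral_distr, simp, simp, subst integral_density)
      (simp_all add: \<Psi>0[OF r] gauss_bounds less_imp_le)
  have LINT_0: "(LINT u|m0. f u) = ?L"
    unfolding m0_def
    by (subst integral_distr, simp, simp, subst integral_density)
      (simp_all add: K gauss_bounds less_imp_le)
  show "(?\<Phi> \<longlongrightarrow> ?L) at_top"
    unfolding LINT_0[symmetric]
    by (rule Lim_transform_eventually[OF weak], use eventually_gt_at_top[of 0] in eventually_elim)
      (rule LINT_r)
  show "integrable ?N (\<lambda>x. ?\<Psi> (inverse r) * gauss (x /\<^sub>R r) * f (gauss (x /\<^sub>R r)))" if r: "r > 0"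
    using int_f[OF sets(1) supp(1) fin_r[OF r]] unfolding m_def
    by (subst (asm) integrable_distr_eq, simp, simp, subst (asm) integrable_density)
      (simp_all add: \<Psi>0[OF r] gauss_bounds less_imp_le)
  show "integrable lborel (\<lambda>y::'a. ?K * norm y powr (\<alpha> - ?d) * gauss y * f (gauss y))"
    using int_f[OF sets(2) supp(2) fin_0] unfolding m0_def
    by (subst (asm) integrable_distr_eq, simp, simp, subst (asm) integrable_density)
      (simp_all add: K gauss_bounds less_imp_le)
qed

section \<open>From shells to the unit sphere\<close>

text \<open>
  For \<open>0 \<le> s < t\<close>, composition with \<open>gauss\<close> gives a continuous function that is positive exactly on the open shell
  \<open>s < norm x < t\<close>.
\<close>

definition bump :: "real \<Rightarrow> real \<Rightarrow> real \<Rightarrow> real" where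
  "bump s t u = max 0 ((u - exp (- t\<^sup>2 / 2)) * (exp (- s\<^sup>2 / 2) - u))"

lemma bump_continuous: "continuous_on UNIV (bump s t)"
  unfolding bump_def by (intro continuous_intros)

lemma bump_nonneg: "0 \<le> bump s t u"
  by (simp add: bump_def)

lemma bump_1: "bump s t 1 = 0"
proof -
  have "(1 - exp (- t\<^sup>2 / 2)) * (exp (- s\<^sup>2 / 2) - 1) \<le> 0"
    by (rule mult_nonneg_nonpos) auto
  then show ?thesis by (simp add: bump_def)
qed

lemma bump_gauss_pos_iff:
  assumes "0 \<le> s" "s < t"
  shows "0 < bump s t (gauss x) \<longleftrightarrow> s < norm x \<and> norm x < t"
proof -
  have sq: "b\<^sup>2 < a\<^sup>2 \<longleftrightarrow> b < a" if "0 \<le> a" "0 \<le> b" for a b :: real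
    using that power2_less_imp_less[of b a] power_strict_mono[of b a 2] by auto
  have "0 < bump s t (gauss x) \<longleftrightarrow> 0 < (gauss x - exp (- t\<^sup>2 / 2)) * (exp (- s\<^sup>2 / 2) - gauss x)"
    by (auto simp: bump_def)
  also have "\<dots> \<longleftrightarrow> (norm x < t \<and> s < norm x) \<or> (t < norm x \<and> norm x < s)"
    using assms by (simp add: zero_less_mult_iff gauss_def sq)
  finally show ?thesis using assms by auto
qed

lemma bump_gauss_mass:
  assumes "0 \<le> s" "s < t"
  shows "integrable lborel (\<lambda>y::'a::euclidean_space. gauss y * bump s t (gauss y))"
    and "0 < (LINT y|(lborel :: 'a measure). gauss y * bump s t (gauss y))"
proof -
  let ?w = "\<lambda>y::'a. gauss y * bump s t (gauss y)"
  have [measurable]: "bump s t \<in> borel_measurable borel"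
    by (rule borel_measurable_continuous_onI[OF bump_continuous])
  have w0: "0 \<le> ?w y" for y by (simp add: gauss_bounds bump_nonneg less_imp_le)
  have bump_le: "bump s t (gauss y) \<le> 1" for y :: 'a
  proof -
    have "(gauss y - exp (- t\<^sup>2 / 2)) * (exp (- s\<^sup>2 / 2) - gauss y) \<le> 1"
    proof -
      have g: "0 \<le> gauss y" "gauss y \<le> 1" by (simp_all add: gauss_bounds less_imp_le)
      have e: "0 \<le> exp (- t\<^sup>2 / 2)" "exp (- t\<^sup>2 / 2) \<le> 1" "0 \<le> exp (- s\<^sup>2 / 2)" "exp (- s\<^sup>2 / 2) \<le> 1"
        by auto
      have "\<bar>gauss y - exp (- t\<^sup>2 / 2)\<bar> * \<bar>exp (- s\<^sup>2 / 2) - gauss y\<bar> \<le> 1 * 1"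
        by (intro mult_mono) (use g e in linarith)+
      then show ?thesis by (simp flip: abs_mult)
    qed
    then show ?thesis by (simp add: bump_def)
  qed
  have "integrable lborel (\<lambda>y::'a. indicator (ball 0 t) y :: real)"
    using emeasure_lborel_ball_finite[of "0::'a" t] by (intro integrable_real_indicator) auto
  then show int: "integrable lborel ?w"
  proof (rule Bochner_Integration.integrable_bound, measurable, intro AE_I2)
    fix y :: 'a
    show "norm (?w y) \<le> norm (indicator (ball 0 t) y :: real)"
    proof (cases "norm y < t")
      case True
      have "?w y \<le> 1 * 1"
        by (intro mult_mono bump_le) (auto simp: gauss_bounds bump_nonneg)
      then show ?thesis using True w0[of y] by simp
    next
      case False
      then have "bump s t (gauss y) = 0"
        using bump_gauss_pos_iff[OF assms, of y] bump_nonneg[of s t "gauss y"] by auto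
      then show ?thesis by simp
    qed
  qed
  show "0 < (LINT y|lborel. ?w y)"
  proof (rule ccontr)
    define U where "U = {y::'a. s < norm y \<and> norm y < t}"
    assume "\<not> ?thesis"
    moreover have "0 \<le> (LINT y|lborel. ?w y)" by (rule integral_nonneg_AE) (simp add: w0)
    ultimately have "(LINT y|lborel. ?w y) = 0" by simp
    then have "AE y in lborel. ?w y = 0"
      using integral_nonneg_eq_0_iff_AE[OF int] w0 by simp
    then have "AE y in lborel. y \<notin> U"
    proof eventually_elim
      fix y assume "?w y = 0"
      then have "bump s t (gauss y) = 0" using gauss_bounds(1)[of y] by simp
      then show "y \<notin> U" using bump_gauss_pos_iff[OF assms, of y] by (simp add: U_def)
    qed
    moreover have "open U"
      unfolding U_def by (intro open_Collect_conj open_Collect_less continuous_intros)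
    ultimately have "U \<in> null_sets lborel"
      by (subst (asm) AE_iff_null_sets[symmetric]) auto
    then have "negligible U"
      using null_sets_completionI negligible_iff_null_sets by blast
    moreover have "U \<noteq> {}"
    proof -
      obtain b :: 'a where "b \<in> Basis" using nonempty_Basis by blast
      then have "((s + t) / 2) *\<^sub>R b \<in> U" using assms by (simp add: U_def)
      then show ?thesis by blast
    qed
    ultimately show False using open_not_negligible[OF \<open>open U\<close>] by blast
  qed
qed

text \<open>
  The bump vanishes at \<open>u = 1\<close>, that is, at the origin, so only the density \<open>G\<close> of the potential
  measure contributes. After the substitution \<open>x = r y\<close> the normalized density of the theorem appears,
  evaluated at \<open>r y\<close> with the normalization taken at \<open>r\<close>.
\<close>

lemma scaled_potential_bump:
  fixes X :: "real \<Rightarrow> 'w \<Rightarrow> 'a::euclidean_space"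
  assumes dim: "DIM('a) \<ge> 3" and proc: "isotropic_unimodal_levy_process M X"
    and lk: "levy_khintchine_exponent M X \<psi>"
    and \<alpha>: "0 < \<alpha>" "\<alpha> \<le> 2" and rv: "regularly_varying_at_zero \<alpha> (radial_profile \<psi>)"
    and G: "ac_part_density (potential_measure M X) G" and r: "r > 0"
    and \<Psi>0: "0 \<le> radial_profile \<psi> (inverse r)"
  shows "ennreal (LINT x|potential_measure M X.
            radial_profile \<psi> (inverse r) * gauss (x /\<^sub>R r) * bump s t (gauss (x /\<^sub>R r))) =
         (\<integral>\<^sup>+y. ennreal (r ^ DIM('a) * radial_profile \<psi> (inverse r) * G (r *\<^sub>R y)) *
            ennreal (gauss y * bump s t (gauss y)) \<partial>lborel)"
proof -
  let ?N = "potential_measure M X" and ?\<Psi> = "radial_profile \<psi> (inverse r)"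
  let ?h = "\<lambda>x::'a. ?\<Psi> * gauss (x /\<^sub>R r) * bump s t (gauss (x /\<^sub>R r))"
  have [measurable]: "bump s t \<in> borel_measurable borel"
    by (rule borel_measurable_continuous_onI[OF bump_continuous])
  have [measurable]: "G \<in> borel_measurable borel" and G0: "\<And>x. 0 \<le> G x"
    using G unfolding ac_part_density_def by auto
  have w0: "0 \<le> gauss y * bump s t (gauss y)" for y :: 'a
    by (simp add: gauss_bounds bump_nonneg less_imp_le)
  have h0: "0 \<le> ?h x" for x
    using mult_nonneg_nonneg[OF \<Psi>0 w0[of "x /\<^sub>R r"]] by (simp add: mult.assoc)
  have "ennreal (LINT x|?N. ?h x) = (\<integral>\<^sup>+x. ennreal (?h x) \<partial>?N)"
    using h0 by (intro nn_integral_eq_integral[symmetric]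
        scaled_potential_vague_limit(2)[OF dim proc lk \<alpha> rv bump_continuous r]) auto
  also have "\<dots> = (\<integral>\<^sup>+x. ennreal (?h x) * ennreal (G x) \<partial>lborel)"
    by (rule nn_integral_vanishing_at_0[OF sets_potential_measure _ _ potential_measure_ac_off_0[OF proc G]])
      (auto simp: bump_1)
  also have "\<dots> = (\<integral>\<^sup>+y. ennreal (r ^ DIM('a)) * (ennreal (?h (r *\<^sub>R y)) * ennreal (G (r *\<^sub>R y))) \<partial>lborel)"
    by (rule nn_integral_lborel_scaleR[OF _ r]) measurable
  also have "\<dots> = (\<integral>\<^sup>+y. ennreal (r ^ DIM('a) * ?\<Psi> * G (r *\<^sub>R y)) *
            ennreal (gauss y * bump s t (gauss y)) \<partial>lborel)"
  proof (rule nn_integral_cong)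
    fix y :: 'a
    have regroup: "ennreal p * (ennreal (q * w) * ennreal g) = ennreal (p * q * g) * ennreal w"
      if "0 \<le> p" "0 \<le> q" "0 \<le> w" "0 \<le> g" for p q w g
      using that by (simp add: ennreal_mult ac_simps)
    have "?h (r *\<^sub>R y) = ?\<Psi> * (gauss y * bump s t (gauss y))"
      using r by simp
    then show "ennreal (r ^ DIM('a)) * (ennreal (?h (r *\<^sub>R y)) * ennreal (G (r *\<^sub>R y))) =
        ennreal (r ^ DIM('a) * ?\<Psi> * G (r *\<^sub>R y)) * ennreal (gauss y * bump s t (gauss y))"
      using r \<Psi>0 G0 w0[of y] by (simp only: regroup zero_le_power less_imp_le)
  qed
  finally show ?thesis .
qed

theorem corollary3:
  fixes M :: "'w measure"
    and X :: "real \<Rightarrow> 'w \<Rightarrow> 'a::euclidean_space"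
    and \<psi> :: "'a \<Rightarrow> real"
    and G :: "'a \<Rightarrow> real"
    and \<alpha> :: real
  assumes "DIM('a) \<ge> 3"
    and "isotropic_unimodal_levy_process M X"
    and "levy_khintchine_exponent M X \<psi>"
    and "potential_density M X G"
    and "0 < \<alpha>" and "\<alpha> \<le> 2"
    and "regularly_varying_at_zero \<alpha> (radial_profile \<psi>)"
  shows "((\<lambda>x. norm x ^ DIM('a) * radial_profile \<psi> (inverse (norm x)) * G x) \<longlongrightarrow>
           2 powr (- \<alpha>) * pi powr (- real DIM('a) / 2)
             * (Gamma ((real DIM('a) - \<alpha>) / 2) / Gamma (\<alpha> / 2))) at_infinity"
proof -
  note dim = assms(1) and proc = assms(2) and lk = assms(3) and \<alpha> = assms(5,6) and rv = assms(7)
  have G: "ac_part_density (potential_measure M X) G" and G_mono: "radially_nonincreasing G"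
    using assms(4) by (simp_all add: potential_density_def)
  have G0: "\<And>x. 0 \<le> G x" using G by (simp add: ac_part_density_def)
  let ?d = "real DIM('a)" and ?\<Psi> = "radial_profile \<psi>"
  define K where "K = riesz_constant ?d \<alpha>"
  have "K > 0" unfolding K_def using \<alpha> dim by (intro riesz_constant_pos) auto
  define H where "H x = norm x ^ DIM('a) * ?\<Psi> (inverse (norm x)) * G x" for x
  have \<Psi>0: "0 \<le> ?\<Psi> (inverse (norm x))" if "x \<noteq> 0" for x :: 'a
  proof -
    have "norm (x /\<^sub>R (norm x)\<^sup>2) = inverse (norm x)"
      using that by (simp add: power2_eq_square)
    then show ?thesis
      using radial_profile_norm[of \<psi> "x /\<^sub>R (norm x)\<^sup>2", OF levy_exponent_radial[OF proc lk]]
        levy_exponent_nonneg[OF proc lk] by metis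
  qed
  define J where "J s t = (LINT y|(lborel :: 'a measure). gauss y * bump s t (gauss y))" for s t
  define \<Phi> where "\<Phi> s t r = (LINT x|potential_measure M X.
      ?\<Psi> (inverse r) * gauss (x /\<^sub>R r) * bump s t (gauss (x /\<^sub>R r)))" for s t r
  define L where "L s t = (LINT y|(lborel :: 'a measure).
      K * norm y powr (\<alpha> - ?d) * gauss y * bump s t (gauss y))" for s t
  have lim: "(\<Phi> s t \<longlongrightarrow> L s t) at_top" for s t
    unfolding \<Phi>_def L_def K_def
    by (rule scaled_potential_vague_limit(1)[OF dim proc lk \<alpha> rv bump_continuous])
  have int_L: "integrable lborel (\<lambda>y::'a. K * norm y powr (\<alpha> - ?d) * gauss y * bump s t (gauss y))" for s t
    unfolding K_def by (rule scaled_potential_vague_limit(3)[OF dim proc lk \<alpha> rv bump_continuous])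
  have w0: "0 \<le> gauss y * bump s t (gauss y)" for y :: 'a and s t
    by (simp add: gauss_bounds bump_nonneg less_imp_le)
  have shell: "s < norm y \<and> norm y < t" if "0 \<le> s" "s < t" "gauss y * bump s t (gauss y) \<noteq> 0" for s t and y :: 'a
    using that bump_gauss_pos_iff[OF that(1,2), of y] bump_nonneg[of s t "gauss y"] by (auto simp: less_le)
  have J_nn: "(\<integral>\<^sup>+y. ennreal c * ennreal (gauss y * bump s t (gauss y)) \<partial>(lborel :: 'a measure)) = ennreal (c * J s t)"
    if "0 \<le> s" "s < t" "0 \<le> c" for s t c
  proof -
    have [measurable]: "bump s t \<in> borel_measurable borel"
      by (rule borel_measurable_continuous_onI[OF bump_continuous])
    have "(\<integral>\<^sup>+y. ennreal c * ennreal (gauss y * bump s t (gauss y)) \<partial>(lborel :: 'a measure))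
        = ennreal c * (\<integral>\<^sup>+y. ennreal (gauss y * bump s t (gauss y)) \<partial>(lborel :: 'a measure))"
      by (rule nn_integral_cmult) measurable
    also have "(\<integral>\<^sup>+y. ennreal (gauss y * bump s t (gauss y)) \<partial>(lborel :: 'a measure)) = ennreal (J s t)"
      unfolding J_def by (intro nn_integral_eq_integral bump_gauss_mass(1)[OF that(1,2)]) (simp add: w0)
    finally show ?thesis using that(3) by (simp add: ennreal_mult')
  qed
  have \<Phi>_nonneg: "0 \<le> \<Phi> s t (norm x)" if "x \<noteq> 0" for s t and x :: 'a
    unfolding \<Phi>_def mult.assoc
    by (intro integral_nonneg_AE AE_I2 mult_nonneg_nonneg[OF \<Psi>0[OF that] w0])
  have upper: "H x * J s t \<le> \<Phi> s t (norm x)" if st: "0 < s" "s < t" "t \<le> 1" and x: "x \<noteq> 0" for s t x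
  proof -
    have H0: "0 \<le> H x" unfolding H_def using \<Psi>0[OF x] G0[of x] by simp
    have "ennreal (H x * J s t) = (\<integral>\<^sup>+y. ennreal (H x) * ennreal (gauss y * bump s t (gauss y)) \<partial>(lborel :: 'a measure))"
      using st H0 by (intro J_nn[symmetric]) auto
    also have "\<dots> \<le> (\<integral>\<^sup>+y. ennreal (norm x ^ DIM('a) * ?\<Psi> (inverse (norm x)) * G (norm x *\<^sub>R y)) *
            ennreal (gauss y * bump s t (gauss y)) \<partial>lborel)"
    proof (rule nn_integral_mono)
      fix y :: 'a
      show "ennreal (H x) * ennreal (gauss y * bump s t (gauss y)) \<le>
          ennreal (norm x ^ DIM('a) * ?\<Psi> (inverse (norm x)) * G (norm x *\<^sub>R y)) * ennreal (gauss y * bump s t (gauss y))"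
      proof (cases "gauss y * bump s t (gauss y) = 0")
        case False
        then have y: "s < norm y" "norm y < t" using shell[of s t y] st by auto
        then have "norm x *\<^sub>R y \<noteq> 0" "norm (norm x *\<^sub>R y) \<le> norm x"
          using st x by (auto intro: mult_left_le)
        then have "G x \<le> G (norm x *\<^sub>R y)"
          using G_mono unfolding radially_nonincreasing_def by blast
        then show ?thesis
          unfolding H_def using \<Psi>0[OF x] by (intro mult_right_mono ennreal_leI mult_left_mono) auto
      qed (simp only: ennreal_0 mult_zero_right order_refl)
    qed
    also have "\<dots> = ennreal (\<Phi> s t (norm x))"
      unfolding \<Phi>_def using x \<Psi>0[OF x]
      by (intro scaled_potential_bump[OF dim proc lk \<alpha> rv G, symmetric]) auto
    finally show ?thesis
      using \<Phi>_nonneg[OF x] by (simp only: ennreal_le_iff)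
  qed
  have lower: "\<Phi> s t (norm x) \<le> H x * J s t" if st: "1 \<le> s" "s < t" and x: "x \<noteq> 0" for s t x
  proof -
    have H0: "0 \<le> H x" unfolding H_def using \<Psi>0[OF x] G0[of x] by simp
    have "ennreal (\<Phi> s t (norm x)) = (\<integral>\<^sup>+y. ennreal (norm x ^ DIM('a) * ?\<Psi> (inverse (norm x)) * G (norm x *\<^sub>R y)) *
            ennreal (gauss y * bump s t (gauss y)) \<partial>lborel)"
      unfolding \<Phi>_def using x \<Psi>0[OF x]
      by (intro scaled_potential_bump[OF dim proc lk \<alpha> rv G]) auto
    also have "\<dots> \<le> (\<integral>\<^sup>+y. ennreal (H x) * ennreal (gauss y * bump s t (gauss y)) \<partial>(lborel :: 'a measure))"
    proof (rule nn_integral_mono)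
      fix y :: 'a
      show "ennreal (norm x ^ DIM('a) * ?\<Psi> (inverse (norm x)) * G (norm x *\<^sub>R y)) * ennreal (gauss y * bump s t (gauss y))
          \<le> ennreal (H x) * ennreal (gauss y * bump s t (gauss y))"
      proof (cases "gauss y * bump s t (gauss y) = 0")
        case False
        then have y: "s < norm y" "norm y < t" using shell[of s t y] st by auto
        then have "norm x \<le> norm (norm x *\<^sub>R y)"
          using st x by (simp add: mult_le_cancel_left1)
        then have "G (norm x *\<^sub>R y) \<le> G x"
          using G_mono x unfolding radially_nonincreasing_def by blast
        then show ?thesis
          unfolding H_def using \<Psi>0[OF x] by (intro mult_right_mono ennreal_leI mult_left_mono) auto
      qed (simp only: ennreal_0 mult_zero_right order_refl)
    qed
    also have "\<dots> = ennreal (H x * J s t)"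
      using st H0 by (intro J_nn) auto
    finally show ?thesis
      using H0 bump_gauss_mass(2)[of s t, where 'a = 'a] st
      by (subst (asm) ennreal_le_iff) (auto simp: J_def[symmetric])
  qed
  have L_bounds: "K * t powr (\<alpha> - ?d) * J s t \<le> L s t" "L s t \<le> K * s powr (\<alpha> - ?d) * J s t"
    if st: "0 < s" "s < t" for s t
  proof -
    have int_J: "integrable lborel (\<lambda>y::'a. c * (gauss y * bump s t (gauss y)))" for c
      using st by (intro integrable_mult_right bump_gauss_mass(1)) auto
    have J_c: "c * J s t = (LINT y|(lborel :: 'a measure). c * (gauss y * bump s t (gauss y)))" for c
      by (simp add: J_def)
    have neg: "\<alpha> - ?d \<le> 0" using \<alpha> dim by simp
    have pw: "t powr (\<alpha> - ?d) \<le> norm y powr (\<alpha> - ?d) \<and> norm y powr (\<alpha> - ?d) \<le> s powr (\<alpha> - ?d)"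
      if "gauss y * bump s t (gauss y) \<noteq> 0" for y :: 'a
      using shell[of s t y] st that neg by (auto intro!: powr_mono2')
    show "K * t powr (\<alpha> - ?d) * J s t \<le> L s t"
      unfolding J_c L_def
    proof (rule integral_mono[OF int_J int_L])
      fix y :: 'a
      show "K * t powr (\<alpha> - ?d) * (gauss y * bump s t (gauss y)) \<le> K * norm y powr (\<alpha> - ?d) * gauss y * bump s t (gauss y)"
      proof (cases "gauss y * bump s t (gauss y) = 0")
        case False
        show ?thesis
          using pw[OF False] w0[of y s t] \<open>K > 0\<close>
          unfolding mult.assoc by (intro mult_left_mono mult_right_mono) auto
      qed auto
    qed
    show "L s t \<le> K * s powr (\<alpha> - ?d) * J s t"
      unfolding J_c L_def
    proof (rule integral_mono[OF int_L int_J])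
      fix y :: 'a
      show "K * norm y powr (\<alpha> - ?d) * gauss y * bump s t (gauss y) \<le> K * s powr (\<alpha> - ?d) * (gauss y * bump s t (gauss y))"
      proof (cases "gauss y * bump s t (gauss y) = 0")
        case False
        show ?thesis
          using pw[OF False] w0[of y s t] \<open>K > 0\<close>
          unfolding mult.assoc by (intro mult_left_mono mult_right_mono) auto
      qed auto
    qed
  qed
  have J_pos: "0 < J s t" if "0 < s" "s < t" for s t
    unfolding J_def using that by (intro bump_gauss_mass(2)) auto
  have cont: "((\<lambda>\<rho>. K * \<rho> powr (\<alpha> - ?d)) \<longlongrightarrow> K) (at 1)"
  proof -
    have "((\<lambda>\<rho>. K * \<rho> powr (\<alpha> - ?d)) \<longlongrightarrow> K * 1 powr (\<alpha> - ?d)) (at 1)"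
      by (intro tendsto_intros) auto
    then show ?thesis by simp
  qed
  have nz: "\<forall>\<^sub>F x in at_infinity. (x::'a) \<noteq> 0"
    by (rule eventually_not_equal_at_infinity)
  have "(H \<longlongrightarrow> K) at_infinity"
  proof (rule order_tendstoI)
    \<comment> \<open>a shell outside the unit sphere, on which the rescaled density is at most its value there\<close>
    fix a assume "a < K"
    then have "\<forall>\<^sub>F \<rho> in at_right 1. a < K * \<rho> powr (\<alpha> - ?d)"
      using order_tendstoD(1)[OF cont] by (simp add: eventually_at_split)
    then have "\<forall>\<^sub>F \<rho> in at_right 1. 1 < \<rho> \<and> a < K * \<rho> powr (\<alpha> - ?d)"
      using eventually_at_right_less[of "1::real"] by eventually_elim simp
    then obtain t where t: "1 < t" "a < K * t powr (\<alpha> - ?d)"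
      using eventually_happens'[OF trivial_limit_at_right_real] by blast
    have "a * J 1 t < K * t powr (\<alpha> - ?d) * J 1 t"
      using t J_pos[of 1 t] by simp
    also have "\<dots> \<le> L 1 t" using L_bounds(1)[of 1 t] t by simp
    finally have "\<forall>\<^sub>F r in at_top. a * J 1 t < \<Phi> 1 t r"
      by (rule order_tendstoD(1)[OF lim])
    then have "\<forall>\<^sub>F x in at_infinity. a * J 1 t < \<Phi> 1 t (norm (x :: 'a))"
      by (rule eventually_compose_filterlim[OF _ filterlim_norm_at_top])
    with nz show "\<forall>\<^sub>F x in at_infinity. a < H x"
    proof eventually_elim
      fix x :: 'a assume "x \<noteq> 0" "a * J 1 t < \<Phi> 1 t (norm x)"
      then have "a * J 1 t < H x * J 1 t" using lower[of 1 t x] t by simp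
      then show "a < H x" using J_pos[of 1 t] t by simp
    qed
  next
    \<comment> \<open>a shell inside the unit sphere\<close>
    fix a assume "K < a"
    then have "\<forall>\<^sub>F \<rho> in at_left 1. K * \<rho> powr (\<alpha> - ?d) < a"
      using order_tendstoD(2)[OF cont] by (simp add: eventually_at_split)
    moreover have "\<forall>\<^sub>F \<rho> in at_left 1. \<rho> \<in> {0<..<1::real}"
      by (rule eventually_at_left_real) simp
    ultimately have "\<forall>\<^sub>F \<rho> in at_left 1. 0 < \<rho> \<and> \<rho> < 1 \<and> K * \<rho> powr (\<alpha> - ?d) < a"
      by eventually_elim simp
    then obtain s where s: "0 < s" "s < 1" "K * s powr (\<alpha> - ?d) < a"
      using eventually_happens'[OF trivial_limit_at_left_real] by blast
    have "L s 1 \<le> K * s powr (\<alpha> - ?d) * J s 1" using L_bounds(2)[of s 1] s by simp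
    also have "\<dots> < a * J s 1"
      using s J_pos[of s 1] by simp
    finally have "\<forall>\<^sub>F r in at_top. \<Phi> s 1 r < a * J s 1"
      by (rule order_tendstoD(2)[OF lim])
    then have "\<forall>\<^sub>F x in at_infinity. \<Phi> s 1 (norm (x :: 'a)) < a * J s 1"
      by (rule eventually_compose_filterlim[OF _ filterlim_norm_at_top])
    with nz show "\<forall>\<^sub>F x in at_infinity. H x < a"
    proof eventually_elim
      fix x :: 'a assume "x \<noteq> 0" "\<Phi> s 1 (norm x) < a * J s 1"
      then have "H x * J s 1 < a * J s 1" using upper[of s 1 x] s by simp
      then show "H x < a" using J_pos[of s 1] s by simp
    qed
  qed
  then show ?thesis
    unfolding H_def K_def riesz_constant_def .
qed

end
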